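(* Let $\mathcal{D}$ be the generating class of a decomposable model for $m$-way contingency tables, with at least two cliques ($|\mathcal{D}|\ge 2$). There exists a unique minimal Markov basis for the model if and only if $\mathcal{G}^{\mathcal{D}}$ has only two boundary cliques $D$ and $D'$ and these satisfy $D''\subset D\cup D'$ for all $D''\in\mathcal{D}$.
   Context: Let $\Delta=\{1,\dots,m\}$ be the set of variables; variable $\delta$ has level set $\mathcal{I}_\delta=\{0,1,\dots,I_\delta-1\}$ with $I_\delta\ge2$, and the cells are $i=(i_1,\dots,i_m)\in\mathcal{I}=\prod_{\delta\in\Delta}\mathcal{I}_\delta$. A contingency table is a nonnegative integer array $\mathbf{n}=\{n(i)\}_{i\in\mathcal{I}}$. For $D\subset\Delta$, $\mathcal{I}_D=\prod_{\delta\in D}\mathcal{I}_\delta$, and the $D$-marginal table $\mathbf{n}_D$ has entries $n_D(i_D)=\sum_{i_{D^C}\in\mathcal{I}_{D^C}}n(i_D,i_{D^C})$. The generating class $\mathcal{D}=\{D_1,\dots,D_r\}$ is the set of facets of a simplicial complex with $\bigcup_jD_j=\Delta$. The independence graph $\mathcal{G}^{\mathcal{D}}$ has vertex set $\Delta$, with distinct $\delta,\delta'$ adjacent iff $\delta,\delta'\in D$ for some $D\in\mathcal{D}$. The model is decomposable if $\mathcal{D}$ is the set of maximal cliques of $\mathcal{G}^{\mathcal{D}}$ and $\mathcal{G}^{\mathcal{D}}$ is chordal (every cycle of length greater than three has a chord). "Clique" means maximal clique. For a clique $D\in\mathcal{D}$, let $\mathrm{Simp}(D)$ be the set of simplicial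 vertices of $\mathcal{G}^{\mathcal{D}}$ in $D$ (vertices whose neighbours are pairwise adjacent) and $\mathrm{Sep}(D)=D\setminus\mathrm{Simp}(D)$. $D$ is a boundary clique if $\mathrm{Simp}(D)\ne\varnothing$ and there exists another clique $\tilde D\in\mathcal{D}$, $\tilde D\neq D$, such that $\mathrm{Sep}(D)=D\cap \tilde D$ (the empty set is allowed). The marginal frequencies of $\mathbf{n}$ are $\mathbf{b}=A\mathbf{n}=\{n_{D_j}(i_{D_j}) : i_{D_j}\in\mathcal{I}_{D_j},\ j=1,\dots,r\}$, and the fiber is $\mathcal{F}_{\mathbf{b}}=\{\mathbf{n}\ge 0\mid A\mathbf{n}=\mathbf{b}\}$. A move is an integer array $\mathbf{z}=\{z(i)\}_{i\in\mathcal{I}}$ with $A\mathbf{z}=\mathbf{0}$. A finite set $\mathcal{M}$ of moves is a Markov basis if for every fiber $\mathcal{F}_{\mathbf{b}}$, any two elements of $\mathcal{F}_{\mathbf{b}}$ can be joined by a finite sequence of elements of $\mathcal{F}_{\mathbf{b}}$ in which consecutive tables differ by $\pm\mathbf{z}$ with $\mathbf{z}\in\mathcal{M}$. A Markov basis is minimal if no proper subset of it is a Markov basis. Moves are considered up to sign ($\mathbf{z}$ is identified with $-\mathbf{z}$), and uniqueness is understood with this identification. *)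

theory Defs
  imports Main "HOL-Library.FuncSet"
begin

text \<open>Variables are natural numbers and variable \<open>\<delta>\<close> has the \<open>L \<delta>\<close> levels \<open>0, \<dots>, L \<delta> - 1\<close>.\<close>

definition cells :: "(nat \<Rightarrow> nat) \<Rightarrow> nat set \<Rightarrow> (nat \<Rightarrow> nat) set" where
  "cells L D = (\<Pi>\<^sub>E \<delta>\<in>D. {0..<L \<delta>})"

text \<open>Arrays are extended by zero off the cells, so that equality of functions is equality of arrays.\<close>

definition arrays :: "(nat \<Rightarrow> nat) \<Rightarrow> nat set \<Rightarrow> ((nat \<Rightarrow> nat) \<Rightarrow> int) set" where
  "arrays L \<Delta> = {z. \<forall>i. i \<notin> cells L \<Delta> \<longrightarrow> z i = 0}"

definition tables :: "(nat \<Rightarrow> nat) \<Rightarrow> nat set \<Rightarrow> ((nat \<Rightarrow> nat) \<Rightarrow> int) set" where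
  "tables L \<Delta> = {n \<in> arrays L \<Delta>. \<forall>i. 0 \<le> n i}"

text \<open>\<open>override_on k j D\<close> is the cell that agrees with \<open>j\<close> on \<open>D\<close> and with \<open>k\<close> on \<open>\<Delta> - D\<close>.\<close>

definition marginal ::
  "(nat \<Rightarrow> nat) \<Rightarrow> nat set \<Rightarrow> nat set \<Rightarrow> ((nat \<Rightarrow> nat) \<Rightarrow> int) \<Rightarrow> (nat \<Rightarrow> nat) \<Rightarrow> int" where
  "marginal L \<Delta> D n j = (\<Sum>k\<in>cells L (\<Delta> - D). n (override_on k j D))"

definition marginal_frequencies ::
  "(nat \<Rightarrow> nat) \<Rightarrow> nat set \<Rightarrow> nat set set \<Rightarrow> ((nat \<Rightarrow> nat) \<Rightarrow> int)
    \<Rightarrow> nat set \<Rightarrow> (nat \<Rightarrow> nat) \<Rightarrow> int" where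
  "marginal_frequencies L \<Delta> \<D> n = (\<lambda>D\<in>\<D>. \<lambda>j\<in>cells L D. marginal L \<Delta> D n j)"

definition fiber ::
  "(nat \<Rightarrow> nat) \<Rightarrow> nat set \<Rightarrow> nat set set \<Rightarrow> (nat set \<Rightarrow> (nat \<Rightarrow> nat) \<Rightarrow> int)
    \<Rightarrow> ((nat \<Rightarrow> nat) \<Rightarrow> int) set" where
  "fiber L \<Delta> \<D> b = {n \<in> tables L \<Delta>. marginal_frequencies L \<Delta> \<D> n = b}"

definition moves ::
  "(nat \<Rightarrow> nat) \<Rightarrow> nat set \<Rightarrow> nat set set \<Rightarrow> ((nat \<Rightarrow> nat) \<Rightarrow> int) set" where
  "moves L \<Delta> \<D> = {z \<in> arrays L \<Delta>. \<forall>D\<in>\<D>. \<forall>j\<in>cells L D. marginal L \<Delta> D z j = 0}"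

definition step_rel ::
  "((nat \<Rightarrow> nat) \<Rightarrow> int) set \<Rightarrow> ((nat \<Rightarrow> nat) \<Rightarrow> int) set
    \<Rightarrow> (((nat \<Rightarrow> nat) \<Rightarrow> int) \<times> ((nat \<Rightarrow> nat) \<Rightarrow> int)) set" where
  "step_rel F M = {(x, y). x \<in> F \<and> y \<in> F \<and> (\<exists>z\<in>M. y - x = z \<or> y - x = - z)}"

definition markov_basis ::
  "(nat \<Rightarrow> nat) \<Rightarrow> nat set \<Rightarrow> nat set set \<Rightarrow> ((nat \<Rightarrow> nat) \<Rightarrow> int) set \<Rightarrow> bool" where
  "markov_basis L \<Delta> \<D> M \<longleftrightarrow> finite M \<and> M \<subseteq> moves L \<Delta> \<D> \<and>
     (\<forall>b. \<forall>x\<in>fiber L \<Delta> \<D> b. \<forall>y\<in>fiber L \<Delta> \<D> b. (x, y) \<in> (step_rel (fiber L \<Delta> \<D> b) M)\<^sup>*)"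

definition minimal_markov_basis ::
  "(nat \<Rightarrow> nat) \<Rightarrow> nat set \<Rightarrow> nat set set \<Rightarrow> ((nat \<Rightarrow> nat) \<Rightarrow> int) set \<Rightarrow> bool" where
  "minimal_markov_basis L \<Delta> \<D> M \<longleftrightarrow>
     markov_basis L \<Delta> \<D> M \<and> (\<forall>M'. M' \<subset> M \<longrightarrow> \<not> markov_basis L \<Delta> \<D> M')"

text \<open>A set of moves up to sign: each \<open>z\<close> is replaced by its class \<open>{z, - z}\<close>.\<close>

definition up_to_sign ::
  "((nat \<Rightarrow> nat) \<Rightarrow> int) set \<Rightarrow> ((nat \<Rightarrow> nat) \<Rightarrow> int) set set" where
  "up_to_sign M = (\<lambda>z. {z, - z}) ` M"

text \<open>A graph is given by a vertex set \<open>V\<close> and a symmetric irreflexive adjacency relation \<open>E\<close>.\<close>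

definition maximal_cliques :: "nat set \<Rightarrow> (nat \<Rightarrow> nat \<Rightarrow> bool) \<Rightarrow> nat set set" where
  "maximal_cliques V E =
     (let clique = (\<lambda>C. C \<subseteq> V \<and> (\<forall>u\<in>C. \<forall>v\<in>C. u \<noteq> v \<longrightarrow> E u v))
      in {C. clique C \<and> (\<forall>C'. clique C' \<and> C \<subseteq> C' \<longrightarrow> C' = C)})"

definition is_cycle :: "nat set \<Rightarrow> (nat \<Rightarrow> nat \<Rightarrow> bool) \<Rightarrow> nat list \<Rightarrow> bool" where
  "is_cycle V E vs \<longleftrightarrow> 3 \<le> length vs \<and> distinct vs \<and> set vs \<subseteq> V \<and>
     (\<forall>k<length vs. E (vs ! k) (vs ! (Suc k mod length vs)))"

text \<open>A chord joins two vertices of the cycle that are not cyclically consecutive.\<close>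

definition has_chord :: "(nat \<Rightarrow> nat \<Rightarrow> bool) \<Rightarrow> nat list \<Rightarrow> bool" where
  "has_chord E vs \<longleftrightarrow> (\<exists>k<length vs. \<exists>l<length vs.
     E (vs ! k) (vs ! l) \<and> l \<noteq> Suc k mod length vs \<and> k \<noteq> Suc l mod length vs)"

definition chordal :: "nat set \<Rightarrow> (nat \<Rightarrow> nat \<Rightarrow> bool) \<Rightarrow> bool" where
  "chordal V E \<longleftrightarrow> (\<forall>vs. is_cycle V E vs \<and> 3 < length vs \<longrightarrow> has_chord E vs)"

definition simplicial_vertex :: "nat set \<Rightarrow> (nat \<Rightarrow> nat \<Rightarrow> bool) \<Rightarrow> nat \<Rightarrow> bool" where
  "simplicial_vertex V E v \<longleftrightarrow> v \<in> V \<and>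
     (\<forall>u\<in>V. \<forall>w\<in>V. E v u \<and> E v w \<and> u \<noteq> w \<longrightarrow> E u w)"

definition simplicial_complex :: "nat set \<Rightarrow> nat set set \<Rightarrow> bool" where
  "simplicial_complex \<Delta> K \<longleftrightarrow> K \<noteq> {} \<and> K \<subseteq> Pow \<Delta> \<and> (\<forall>F\<in>K. \<forall>G. G \<subseteq> F \<longrightarrow> G \<in> K)"

definition facets :: "nat set set \<Rightarrow> nat set set" where
  "facets K = {F \<in> K. \<forall>G\<in>K. F \<subseteq> G \<longrightarrow> G = F}"

definition generating_class :: "nat set \<Rightarrow> nat set set \<Rightarrow> bool" where
  "generating_class \<Delta> \<D> \<longleftrightarrow> (\<exists>K. simplicial_complex \<Delta> K \<and> \<D> = facets K) \<and> \<Union>\<D> = \<Delta>"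

definition independence_graph :: "nat set set \<Rightarrow> nat \<Rightarrow> nat \<Rightarrow> bool" where
  "independence_graph \<D> u v \<longleftrightarrow> u \<noteq> v \<and> (\<exists>D\<in>\<D>. u \<in> D \<and> v \<in> D)"

definition decomposable :: "nat set \<Rightarrow> nat set set \<Rightarrow> bool" where
  "decomposable \<Delta> \<D> \<longleftrightarrow>
     \<D> = maximal_cliques \<Delta> (independence_graph \<D>) \<and> chordal \<Delta> (independence_graph \<D>)"

definition Simp :: "nat set \<Rightarrow> nat set set \<Rightarrow> nat set \<Rightarrow> nat set" where
  "Simp \<Delta> \<D> D = {v \<in> D. simplicial_vertex \<Delta> (independence_graph \<D>) v}"

definition Sep :: "nat set \<Rightarrow> nat set set \<Rightarrow> nat set \<Rightarrow> nat set" where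
  "Sep \<Delta> \<D> D = D - Simp \<Delta> \<D> D"

definition boundary_cliques :: "nat set \<Rightarrow> nat set set \<Rightarrow> nat set set" where
  "boundary_cliques \<Delta> \<D> =
     {D \<in> \<D>. Simp \<Delta> \<D> D \<noteq> {} \<and> (\<exists>D'\<in>\<D>. D' \<noteq> D \<and> Sep \<Delta> \<D> D = D \<inter> D')}"

end

theory Submission
  imports Defs "HOL-Library.Multiset" "HOL-Library.Function_Algebras"
begin

text \<open>Both sides are equivalent to the independence graph having no three pairwise non-adjacent
  vertices. A table is a multiset of cells, and a marginal table is its image under restriction, so
  a simple induction along a perfect elimination ordering connects every fiber by swaps of two
  cells. If \<open>\<Delta> = D \<union> D'\<close> for two cliques, a fiber of tables with two counts has at most two elements,
  so every such swap is forced, up to sign, in every Markov basis. If there are three pairwise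
  non-adjacent vertices, some fiber of tables with two counts has at least three elements, and a
  move between two of them may be traded for the two moves through a third. On the graph side,
  chordality without an independent triple gives two non-adjacent simplicial vertices, whose
  cliques cover the graph and are its boundary cliques.\<close>

section \<open>Tables as multisets of cells\<close>

definition samples :: "(nat \<Rightarrow> nat) \<Rightarrow> nat set \<Rightarrow> (nat \<Rightarrow> nat) multiset set" where
  "samples L V = {X. set_mset X \<subseteq> cells L V}"

definition tab :: "'a multiset \<Rightarrow> 'a \<Rightarrow> int" where
  "tab X = (\<lambda>i. int (count X i))"

definition proj :: "nat set \<Rightarrow> (nat \<Rightarrow> nat) multiset \<Rightarrow> (nat \<Rightarrow> nat) multiset" where
  "proj D X = image_mset (\<lambda>i. restrict i D) X"

definition same_margins ::
  "nat set set \<Rightarrow> (nat \<Rightarrow> nat) multiset \<Rightarrow> (nat \<Rightarrow> nat) multiset \<Rightarrow> bool" where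
  "same_margins \<C> X Y \<longleftrightarrow> (\<forall>C\<in>\<C>. proj C X = proj C Y)"

lemma proj_simps [simp]:
  "proj D {#} = {#}" "proj D (add_mset p X) = add_mset (restrict p D) (proj D X)"
  "proj D (X + Y) = proj D X + proj D Y" "size (proj D X) = size X"
  by (simp_all add: proj_def)

lemma proj_proj: "proj C (proj D X) = proj (C \<inter> D) X"
  by (simp add: proj_def multiset.map_comp comp_def restrict_restrict Int_commute)

lemma tab_inject [simp]: "tab X = tab Y \<longleftrightarrow> X = Y"
  by (auto simp: tab_def fun_eq_iff multiset_eq_iff)

lemma samples_simps [simp]:
  "{#} \<in> samples L V" "add_mset p X \<in> samples L V \<longleftrightarrow> p \<in> cells L V \<and> X \<in> samples L V"
  "X + Y \<in> samples L V \<longleftrightarrow> X \<in> samples L V \<and> Y \<in> samples L V"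
  by (auto simp: samples_def)

lemma samplesD: "X \<in> samples L V \<Longrightarrow> p \<in># X \<Longrightarrow> p \<in> cells L V"
  by (auto simp: samples_def)

lemma finite_cells [simp]: "finite V \<Longrightarrow> finite (cells L V)"
  by (simp add: cells_def finite_PiE)

lemma restrict_cells: "p \<in> cells L V \<Longrightarrow> D \<subseteq> V \<Longrightarrow> restrict p D \<in> cells L D"
  by (auto simp: cells_def PiE_def Pi_def)

lemma proj_samples: "X \<in> samples L V \<Longrightarrow> D \<subseteq> V \<Longrightarrow> proj D X \<in> samples L D"
  by (auto simp: samples_def proj_def intro: restrict_cells)

lemma restrict_eq_iff: "restrict p D = restrict q D \<longleftrightarrow> (\<forall>v\<in>D. p v = q v)"
  by (auto simp: fun_eq_iff restrict_def)

lemma cells_eqI: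
  assumes "p \<in> cells L V" "q \<in> cells L V" "\<And>v. v \<in> V \<Longrightarrow> p v = q v"
  shows "p = q"
  using assms unfolding cells_def by (blast intro: PiE_ext)

lemma proj_full: "X \<in> samples L V \<Longrightarrow> proj V X = X"
  unfolding proj_def samples_def cells_def
  by (subst image_mset_cong[where g = "\<lambda>i. i"]) (auto intro: PiE_restrict)

text \<open>There are finitely many cells, so the entries of a table are the multiplicities of a
  finite multiset. Fibers can thus be studied through samples.\<close>

lemma tables_eq:
  assumes "finite \<Delta>"
  shows "tables L \<Delta> = tab ` samples L \<Delta>"
proof
  show "tab ` samples L \<Delta> \<subseteq> tables L \<Delta>"
    by (auto simp: tables_def arrays_def tab_def samples_def count_eq_zero_iff)
  show "tables L \<Delta> \<subseteq> tab ` samples L \<Delta>"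
  proof
    fix n assume n: "n \<in> tables L \<Delta>"
    define X where "X = Abs_multiset (\<lambda>i. nat (n i))"
    have "{i. 0 < nat (n i)} \<subseteq> cells L \<Delta>"
      using n by (force simp: tables_def arrays_def)
    then have "finite {i. 0 < nat (n i)}"
      using assms by (meson finite_cells finite_subset)
    then have c: "count X i = nat (n i)" for i
      by (simp add: X_def count_Abs_multiset)
    have "tab X = n"
      using n by (simp add: tab_def c tables_def)
    moreover have "X \<in> samples L \<Delta>"
    proof -
      have "i \<in> cells L \<Delta>" if "i \<in># X" for i
        using that n c[of i] count_eq_zero_iff[of X i] by (force simp: tables_def arrays_def)
      then show ?thesis by (auto simp: samples_def)
    qed
    ultimately show "n \<in> tab ` samples L \<Delta>" by blast
  qed
qed

text \<open>Filling in the levels of \<open>j\<close> turns the cells off \<open>D\<close>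
  bijectively into the full cells that restrict to \<open>j\<close>. The marginal is then a sum over
  a preimage of the restriction map, as in the count of an image multiset.\<close>

lemma marginal_tab:
  assumes "finite \<Delta>" "D \<subseteq> \<Delta>" "X \<in> samples L \<Delta>" "j \<in> cells L D"
  shows "marginal L \<Delta> D (tab X) j = int (count (proj D X) j)"
proof -
  let ?A = "{i \<in> cells L \<Delta>. restrict i D = j}"
  have "(\<Sum>k\<in>cells L (\<Delta> - D). tab X (override_on k j D)) = (\<Sum>i\<in>?A. tab X i)"
  proof (rule sum.reindex_bij_witness[where i = "\<lambda>i. restrict i (\<Delta> - D)"
        and j = "\<lambda>k. override_on k j D"])
    fix k assume k: "k \<in> cells L (\<Delta> - D)"
    show "restrict (override_on k j D) (\<Delta> - D) = k"
      using k by (auto simp: fun_eq_iff cells_def PiE_def extensional_def override_on_def)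
    show "override_on k j D \<in> ?A"
      using k assms
      by (auto simp: fun_eq_iff cells_def PiE_def Pi_iff extensional_def override_on_def)
  next
    fix i assume i: "i \<in> ?A"
    then have "j = restrict i D" "i \<in> cells L \<Delta>" by auto
    then show "override_on (restrict i (\<Delta> - D)) j D = i"
      using assms(2) by (auto simp: fun_eq_iff cells_def PiE_def extensional_def override_on_def)
    show "restrict i (\<Delta> - D) \<in> cells L (\<Delta> - D)"
      using i by (auto intro: restrict_cells)
  qed simp
  \<comment> \<open>Cells outside the support of \<open>X\<close> contribute zero; dropping them
    gives the sum used by \<open>count_image_mset\<close>.\<close>
  also have "\<dots> = (\<Sum>i\<in>(\<lambda>i. restrict i D) -` {j} \<inter> set_mset X. tab X i)"
    using assms by (intro sum.mono_neutral_right) (auto simp: samples_def tab_def count_eq_zero_iff)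
  finally show ?thesis
    by (simp add: marginal_def proj_def count_image_mset tab_def)
qed

text \<open>Projected samples have no counts outside \<open>cells L D\<close>, so agreement of the
  marginals on these cells is equality of multisets.\<close>

lemma marginal_frequencies_tab_eq_iff:
  assumes "finite \<Delta>" "\<Union>\<D> = \<Delta>" "X \<in> samples L \<Delta>" "Y \<in> samples L \<Delta>"
  shows "marginal_frequencies L \<Delta> \<D> (tab X) = marginal_frequencies L \<Delta> \<D> (tab Y)
    \<longleftrightarrow> same_margins \<D> X Y"
proof -
  have "(\<lambda>j\<in>cells L D. marginal L \<Delta> D (tab X) j) = (\<lambda>j\<in>cells L D. marginal L \<Delta> D (tab Y) j)
      \<longleftrightarrow> proj D X = proj D Y" if "D \<in> \<D>" for D
  proof -
    have D: "D \<subseteq> \<Delta>" using that assms by auto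
    have "(\<lambda>j\<in>cells L D. marginal L \<Delta> D (tab X) j) = (\<lambda>j\<in>cells L D. marginal L \<Delta> D (tab Y) j)
      \<longleftrightarrow> (\<forall>j\<in>cells L D. count (proj D X) j = count (proj D Y) j)"
      using assms D by (auto simp: fun_eq_iff restrict_def marginal_tab)
    also have "\<dots> \<longleftrightarrow> (\<forall>j. count (proj D X) j = count (proj D Y) j)"
      using proj_samples[OF assms(3) D] proj_samples[OF assms(4) D]
      by (auto simp: samples_def) (metis count_eq_zero_iff subsetD)
    finally show ?thesis by (simp add: multiset_eq_iff)
  qed
  then show ?thesis
    unfolding marginal_frequencies_def same_margins_def
    by (auto simp: fun_eq_iff restrict_def)
qed

lemma size_2_mset: "size X = 2 \<Longrightarrow> \<exists>p q. X = {#p, q#}"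
  by (metis One_nat_def Suc_1 nat.inject size_1_singleton_mset size_add_mset size_eq_Suc_imp_eq_union)

lemma size_2_mset_contains:
  assumes "size X = 2" "p \<in># X"
  obtains q where "X = {#p, q#}"
  using assms multi_member_split[of p X] size_1_singleton_mset by force

lemma mset_pair_eq: "{#a, b#} = {#c, d#} \<longleftrightarrow> a = c \<and> b = d \<or> a = d \<and> b = c"
  by (auto simp: add_eq_conv_ex)

section \<open>Connecting fibers by swaps\<close>

text \<open>The case \<open>X = Y\<close> is allowed; such trivial swaps are sorted out in
  \<open>quadratic_moves_markov_basis\<close>.\<close>

definition swaps ::
  "(nat \<Rightarrow> nat) \<Rightarrow> nat set \<Rightarrow> nat set set \<Rightarrow> ((nat \<Rightarrow> nat) multiset \<times> (nat \<Rightarrow> nat) multiset) set"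
  where "swaps L V \<C> = {(T + X, T + Y) | T X Y. T + X \<in> samples L V \<and> T + Y \<in> samples L V \<and>
    size X = 2 \<and> size Y = 2 \<and> same_margins \<C> X Y}"

lemma swaps_samples: "(X, Y) \<in> swaps L V \<C> \<Longrightarrow> Y \<in> samples L V"
  by (auto simp: swaps_def)

lemma swaps_star_samples: "(X, Y) \<in> (swaps L V \<C>)\<^sup>* \<Longrightarrow> X \<in> samples L V \<Longrightarrow> Y \<in> samples L V"
  by (induction rule: rtrancl_induct) (auto dest: swaps_samples)

lemma swaps_star_same_margins: "(X, Y) \<in> (swaps L V \<C>)\<^sup>* \<Longrightarrow> same_margins \<C> X Y"
  by (induction rule: rtrancl_induct) (auto simp: swaps_def same_margins_def)

lemma swaps_add:
  assumes "(X, Y) \<in> swaps L V \<C>" "W \<in> samples L V"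
  shows "(W + X, W + Y) \<in> swaps L V \<C>"
proof -
  obtain T A B where "X = T + A" "Y = T + B" "T + A \<in> samples L V" "T + B \<in> samples L V"
    "size A = 2" "size B = 2" "same_margins \<C> A B"
    using assms(1) by (auto simp: swaps_def)
  then show ?thesis
    unfolding swaps_def mem_Collect_eq using assms(2)
    by (intro exI[of _ "W + T"] exI[of _ A] exI[of _ B]) (simp add: add.assoc)
qed

lemma swaps_star_add:
  assumes "(X, Y) \<in> (swaps L V \<C>)\<^sup>*" "W \<in> samples L V"
  shows "(W + X, W + Y) \<in> (swaps L V \<C>)\<^sup>*"
  using assms by (induction rule: rtrancl_induct) (auto intro: rtrancl_into_rtrancl swaps_add)

text \<open>Take \<open>p\<close> in \<open>X\<close>, a cell \<open>p'\<close> of \<open>Y\<close>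
  with the \<open>H\<close>-part of \<open>p\<close>, and a cell \<open>p''\<close> of
  \<open>X\<close> with the \<open>D\<close>-part of \<open>p'\<close>. Exchanging the
  \<open>D\<close>-parts of \<open>p\<close> and \<open>p''\<close> creates \<open>p'\<close> in
  \<open>X\<close>; it is then removed from both samples.\<close>

lemma swaps_connect_two_blocks:
  assumes "V = H \<union> D" and \<C>: "\<And>C. C \<in> \<C> \<Longrightarrow> C \<subseteq> H \<or> C \<subseteq> D"
    and "X \<in> samples L V" "Y \<in> samples L V" "proj H X = proj H Y" "proj D X = proj D Y"
  shows "(X, Y) \<in> (swaps L V \<C>)\<^sup>*"
  using assms(3-)
proof (induction "size X" arbitrary: X Y)
  case 0
  then have "X = {#}" "Y = {#}"
    by (auto simp: proj_def)
  then show ?case by simp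
next
  case (Suc k)
  obtain p X' where X: "X = add_mset p X'" using Suc.hyps(2) by (metis size_eq_Suc_imp_eq_union)
  have "restrict p H \<in># proj H Y" using Suc.prems(3) by (simp add: X flip: Suc.prems(3))
  then obtain p' where p': "p' \<in># Y" "restrict p' H = restrict p H" by (auto simp: proj_def)
  then obtain Y' where Y: "Y = add_mset p' Y'" by (meson multi_member_split)
  have "restrict p' D \<in># proj D X" by (simp add: Y Suc.prems(4))
  then obtain p'' where p'': "p'' \<in># X" "restrict p'' D = restrict p' D" by (auto simp: proj_def)
  have cl: "p \<in> cells L V" "p' \<in> cells L V" "p'' \<in> cells L V"
    using Suc.prems(1,2) X Y p''(1) by (auto dest: samplesD)
  show ?case
  proof (cases "p'' = p")
    \<comment> \<open>Here \<open>p'\<close> agrees with \<open>p\<close> on both blocks, so the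
      samples already share a cell.\<close>
    case True
    have "p' = p"
      using cl(2,1) by (rule cells_eqI) (use True p' p'' assms(1) in \<open>auto simp: restrict_eq_iff\<close>)
    then have "(X', Y') \<in> (swaps L V \<C>)\<^sup>*"
      using Suc.prems Suc.hyps(2) X Y by (intro Suc.hyps(1)) auto
    from swaps_star_add[OF this, of "{#p#}"] show ?thesis
      using cl X Y \<open>p' = p\<close> by simp
  next
    case False
    then obtain T where T: "X' = add_mset p'' T"
      using p''(1) X by (metis insert_noteq_member multi_member_split)
    \<comment> \<open>The second cell made by the exchange. All three cells agree on the overlap of
      \<open>H\<close> and \<open>D\<close>, so \<open>q\<close> also has the whole
      \<open>H\<close>-part of \<open>p''\<close>.\<close>
    define q where "q = override_on p'' p D"
    have qD: "restrict q D = restrict p D"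
      by (auto simp: q_def restrict_eq_iff)
    have qH: "restrict q H = restrict p'' H"
      using p' p'' by (auto simp: q_def restrict_eq_iff override_on_def)
    have q: "q \<in> cells L V"
      using cl by (auto simp: q_def cells_def override_on_def PiE_def extensional_def Pi_def)
    have sub: "restrict r C = restrict s C" if "restrict r B = restrict s B" "C \<subseteq> B"
      for r s :: "nat \<Rightarrow> nat" and B C
      using that by (auto simp: restrict_eq_iff)
    have "same_margins \<C> {#p, p''#} {#p', q#}"
      unfolding same_margins_def
    proof
      fix C assume "C \<in> \<C>"
      then consider "C \<subseteq> H" | "C \<subseteq> D" using \<C> by blast
      then show "proj C {#p, p''#} = proj C {#p', q#}"
        by cases (use sub[OF p'(2)] sub[OF p''(2)] sub[OF qD] sub[OF qH] in
            \<open>simp_all add: add_mset_commute\<close>)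
    qed
    moreover have "T \<in> samples L V" using Suc.prems X T by simp
    ultimately have "(T + {#p, p''#}, T + {#p', q#}) \<in> swaps L V \<C>"
      unfolding swaps_def mem_Collect_eq using cl q
      by (intro exI[of _ T] exI[of _ "{#p, p''#}"] exI[of _ "{#p', q#}"]) auto
    moreover have "(add_mset q T, Y') \<in> (swaps L V \<C>)\<^sup>*"
    proof (rule Suc.hyps(1))
      show "k = size (add_mset q T)" using Suc.hyps(2) X T by simp
      show "add_mset q T \<in> samples L V" "Y' \<in> samples L V"
        using q Suc.prems X Y T by auto
      show "proj H (add_mset q T) = proj H Y'"
        using Suc.prems(3) X Y T p'(2) qH by simp
      show "proj D (add_mset q T) = proj D Y'"
        using Suc.prems(4) X Y T p''(2) qD by (simp add: add_mset_commute)
    qed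
    from swaps_star_add[OF this, of "{#p'#}"]
    have "(T + {#p', q#}, Y) \<in> (swaps L V \<C>)\<^sup>*"
      using cl Y by (simp add: add_mset_commute)
    ultimately show ?thesis using X T by (simp add: add_mset_commute converse_rtrancl_into_rtrancl)
  qed
qed

section \<open>Elimination of a simplicial vertex\<close>

text \<open>Non-maximal cliques are included so that the family passes to induced subgraphs and
  contains the neighbourhood of a simplicial vertex. \<open>same_margins_cliques\<close> leads back
  to the generating class.\<close>

definition cliques :: "nat set \<Rightarrow> (nat \<Rightarrow> nat \<Rightarrow> bool) \<Rightarrow> nat set set" where
  "cliques V E = {C. C \<subseteq> V \<and> (\<forall>u\<in>C. \<forall>v\<in>C. u \<noteq> v \<longrightarrow> E u v)}"

text \<open>Since \<open>N\<close> is a clique, the swap preserves the \<open>N\<close>-margin, so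
  each new cell can be paired with an old one agreeing with it on \<open>N\<close> and inherit its
  level at \<open>v\<close>. Cliques through \<open>v\<close> lie in \<open>insert v N\<close>,
  where nothing changes; for the other cliques the given swap preserves the margins.\<close>

lemma swap_lift:
  assumes v: "v \<in> V" and N: "N = {u \<in> V - {v}. E v u}" "N \<in> cliques (V - {v}) E"
    and X: "X \<in> samples L V"
    and step: "(proj (V - {v}) X, Z) \<in> swaps L (V - {v}) (cliques (V - {v}) E)"
  shows "\<exists>X'. (X, X') \<in> swaps L V (cliques V E) \<and> proj (V - {v}) X' = Z"
proof -
  let ?H = "V - {v}"
  obtain T A B where A: "proj ?H X = T + A" "Z = T + B" "T + A \<in> samples L ?H"
    "T + B \<in> samples L ?H" "size A = 2" "size B = 2" "same_margins (cliques ?H E) A B"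
    using step by (auto simp: swaps_def)
  \<comment> \<open>A splitting of the projected sample comes from a splitting of \<open>X\<close>
    itself.\<close>
  obtain T' A' where A': "X = T' + A'" "T = proj ?H T'" "A = proj ?H A'"
    using image_mset_eq_plusD[OF A(1)[unfolded proj_def]] unfolding proj_def by blast
  obtain P Q where PQ: "A' = {#P, Q#}"
    using size_2_mset[of A'] A(5) A' by auto
  have "\<exists>p q. B = {#p, q#} \<and> restrict p N = restrict P N \<and> restrict q N = restrict Q N"
  proof -
    obtain p q where B: "B = {#p, q#}" using size_2_mset[OF A(6)] by blast
    have "proj N A = proj N B" using A(7) N(2) by (auto simp: same_margins_def)
    then have "proj N A' = proj N B"
      using N(1) by (simp add: A'(3) proj_proj Int_absorb2 subset_iff)
    then have "{#restrict P N, restrict Q N#} = {#restrict p N, restrict q N#}"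
      by (simp add: PQ B)
    then consider "restrict p N = restrict P N" "restrict q N = restrict Q N"
      | "restrict q N = restrict P N" "restrict p N = restrict Q N"
      unfolding mset_pair_eq by fastforce
    then show ?thesis
      unfolding B by cases (blast, metis add_mset_commute)
  qed
  then obtain p q where B: "B = {#p, q#}" and pN: "restrict p N = restrict P N"
    and qN: "restrict q N = restrict Q N" by blast
  define P' Q' where "P' = p(v := P v)" and "Q' = q(v := Q v)"
  have pq: "p \<in> cells L ?H" "q \<in> cells L ?H" using A(4) B by auto
  have PQc: "P \<in> cells L V" "Q \<in> cells L V" using X A' PQ by auto
  have c: "P' \<in> cells L V" "Q' \<in> cells L V"
    using pq PQc v by (auto simp: P'_def Q'_def cells_def PiE_def extensional_def Pi_def)
  have r: "restrict P' ?H = p" "restrict Q' ?H = q"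
    using pq by (auto simp: P'_def Q'_def cells_def PiE_def extensional_def fun_eq_iff)
  have "same_margins (cliques V E) {#P, Q#} {#P', Q'#}"
    unfolding same_margins_def
  proof
    fix C assume C: "C \<in> cliques V E"
    show "proj C {#P, Q#} = proj C {#P', Q'#}"
    proof (cases "v \<in> C")
      case True
      then have "C \<subseteq> insert v N" using C by (auto simp: cliques_def N(1))
      then have "restrict P' C = restrict P C" "restrict Q' C = restrict Q C"
        using pN qN by (auto simp: P'_def Q'_def restrict_eq_iff)
      then show ?thesis by simp
    next
      case False
      then have "C \<in> cliques ?H E" using C by (auto simp: cliques_def)
      moreover from this have "C \<inter> ?H = C" by (auto simp: cliques_def)
      moreover have "A = proj ?H {#P, Q#}" "B = proj ?H {#P', Q'#}"
        using A'(3) PQ B r by auto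
      ultimately show ?thesis
        using A(7) unfolding same_margins_def by (metis proj_proj)
    qed
  qed
  then have "(X, T' + {#P', Q'#}) \<in> swaps L V (cliques V E)"
    unfolding swaps_def mem_Collect_eq using X A' PQ c
    by (intro exI[of _ T'] exI[of _ "{#P, Q#}"] exI[of _ "{#P', Q'#}"]) auto
  moreover have "proj ?H (T' + {#P', Q'#}) = Z"
    using A A' B r by simp
  ultimately show ?thesis by blast
qed

lemma swaps_star_lift:
  assumes v: "v \<in> V" and N: "N = {u \<in> V - {v}. E v u}" "N \<in> cliques (V - {v}) E"
    and X: "X \<in> samples L V"
    and "(proj (V - {v}) X, Z) \<in> (swaps L (V - {v}) (cliques (V - {v}) E))\<^sup>*"
  shows "\<exists>X'. (X, X') \<in> (swaps L V (cliques V E))\<^sup>* \<and> proj (V - {v}) X' = Z"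
  using assms(5)
proof (induction rule: rtrancl_induct)
  case base
  then show ?case by blast
next
  case (step Y Z)
  then obtain X' where X': "(X, X') \<in> (swaps L V (cliques V E))\<^sup>*" "proj (V - {v}) X' = Y"
    by blast
  with swap_lift[OF v N swaps_star_samples[OF X'(1) X]] step(2)
  show ?case by (metis rtrancl_into_rtrancl)
qed

text \<open>Eliminating a simplicial vertex \<open>v\<close>, with neighbourhood \<open>N\<close>: the projections to \<open>V - {v}\<close>
  are connected by induction, these swaps lift because \<open>N\<close> is a clique, and two samples with the
  same projection to \<open>V - {v}\<close> are handled as a model with the two cliques \<open>V - {v}\<close> and
  \<open>insert v N\<close>.\<close>

lemma swaps_connect:
  assumes "finite V" and sym: "\<And>u v. E u v \<Longrightarrow> E v u" and irr: "\<And>u. \<not> E u u"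
    and elim: "\<And>W. W \<subseteq> V \<Longrightarrow> W \<noteq> {} \<Longrightarrow> \<exists>v\<in>W. simplicial_vertex W E v"
    and "X \<in> samples L V" "Y \<in> samples L V" "same_margins (cliques V E) X Y"
  shows "(X, Y) \<in> (swaps L V (cliques V E))\<^sup>*"
  using assms(1,4-)
proof (induction V arbitrary: X Y rule: finite_psubset_induct)
  case (psubset V)
  show ?case
  proof (cases "V = {}")
    case True
    \<comment> \<open>The empty set is itself a clique here, so the margin at \<open>V\<close> is
      available.\<close>
    then have "proj V X = proj V Y" using psubset.prems(4) by (auto simp: same_margins_def cliques_def)
    then have "X = Y" using psubset.prems(2,3) proj_full by metis
    then show ?thesis by simp
  next
    case False
    then obtain v where v: "v \<in> V" "simplicial_vertex V E v" using psubset.prems(1)[of V] by blast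
    define H N where "H = V - {v}" and "N = {u \<in> V - {v}. E v u}"
    have H: "H \<subset> V" using v by (auto simp: H_def)
    have N: "N \<in> cliques H E"
      using v unfolding N_def H_def cliques_def simplicial_vertex_def by blast
    have D: "insert v N \<in> cliques V E"
    proof -
      have "E v u" "E u v" if "u \<in> N" for u using that sym[of v u] by (auto simp: N_def)
      then show ?thesis using N v(1) by (auto simp: cliques_def H_def)
    qed
    have "same_margins (cliques H E) (proj H X) (proj H Y)"
      unfolding same_margins_def
    proof
      fix C assume C: "C \<in> cliques H E"
      then have "C \<in> cliques V E" "C \<inter> H = C" using H by (auto simp: cliques_def)
      then show "proj C (proj H X) = proj C (proj H Y)"
        using psubset.prems(4) by (simp add: proj_proj same_margins_def)
    qed
    then have "(proj H X, proj H Y) \<in> (swaps L H (cliques H E))\<^sup>*"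
    proof (rule psubset.IH[OF H, rotated -1])
      show "\<exists>v\<in>W. simplicial_vertex W E v" if "W \<subseteq> H" "W \<noteq> {}" for W
        using that H by (intro psubset.prems(1)) auto
      show "proj H X \<in> samples L H" "proj H Y \<in> samples L H"
        using psubset.prems(2,3) H by (auto intro: proj_samples)
    qed
    from swaps_star_lift[OF v(1) N_def N[unfolded H_def] psubset.prems(2) this[unfolded H_def]]
    obtain X' where X': "(X, X') \<in> (swaps L V (cliques V E))\<^sup>*" "proj H X' = proj H Y"
      by (auto simp: H_def)
    \<comment> \<open>The lifted swaps keep all clique margins, so \<open>X'\<close> agrees with
      \<open>Y\<close> on \<open>insert v N\<close> as well as on \<open>H\<close>.\<close>
    have "(X', Y) \<in> (swaps L V (cliques V E))\<^sup>*"
    proof (rule swaps_connect_two_blocks[where H = H and D = "insert v N"])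
      show "V = H \<union> insert v N" using v by (auto simp: H_def N_def)
      show "C \<subseteq> H \<or> C \<subseteq> insert v N" if "C \<in> cliques V E" for C
        using that by (auto simp: cliques_def H_def N_def)
      show "X' \<in> samples L V" using X'(1) psubset.prems(2) swaps_star_samples by blast
      show "proj (insert v N) X' = proj (insert v N) Y"
        using swaps_star_same_margins[OF X'(1)] psubset.prems(4) D
        by (auto simp: same_margins_def)
    qed (use X'(2) psubset.prems(3) in auto)
    then show ?thesis using X'(1) by simp
  qed
qed

section \<open>Markov bases in terms of samples\<close>

text \<open>A nonempty generating class ensures that the marginals determine the total count; see
  \<open>same_size\<close>.\<close>

locale contingency_model =
  fixes L :: "nat \<Rightarrow> nat" and \<Delta> :: "nat set" and \<D> :: "nat set set"
  assumes finite_vars: "finite \<Delta>" and Union_gens: "\<Union>\<D> = \<Delta>" and gens_nonempty: "\<D> \<noteq> {}"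
begin

abbreviation "S \<equiv> samples L \<Delta>"

abbreviation "same \<equiv> same_margins \<D>"

text \<open>One relation serves all fibers: \<open>same X Y\<close> keeps each step inside its
  fiber.\<close>

definition sample_steps where
  "sample_steps M = {(X, Y). X \<in> S \<and> Y \<in> S \<and> same X Y \<and>
     (\<exists>z\<in>M. tab Y - tab X = z \<or> tab Y - tab X = - z)}"

text \<open>By \<open>size_2_share_cell\<close> nothing cancels in these differences, so they are
  the moves of degree two.\<close>

definition quadratic_moves where
  "quadratic_moves = {tab Y - tab X | X Y. X \<in> S \<and> Y \<in> S \<and> size X = 2 \<and> same X Y \<and> X \<noteq> Y}"

lemma same_refl [simp]: "same X X"
  by (simp add: same_margins_def)

lemma same_sym: "same X Y \<Longrightarrow> same Y X"
  by (simp add: same_margins_def)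

lemma same_trans: "same X Y \<Longrightarrow> same Y Z \<Longrightarrow> same X Z"
  by (simp add: same_margins_def)

lemma same_size: "same X Y \<Longrightarrow> size X = size Y"
  using gens_nonempty by (metis all_not_in_conv proj_simps(4) same_margins_def)

lemma tab_in_fiber_iff:
  assumes "X \<in> S" "Y \<in> S"
  shows "tab Y \<in> fiber L \<Delta> \<D> (marginal_frequencies L \<Delta> \<D> (tab X)) \<longleftrightarrow> same X Y"
  using marginal_frequencies_tab_eq_iff[OF finite_vars Union_gens assms] assms
  by (auto simp: fiber_def tables_eq[OF finite_vars])

lemma sample_steps_star_S:
  "(X, Y) \<in> (sample_steps M)\<^sup>* \<Longrightarrow> X \<in> S \<Longrightarrow> Y \<in> S \<and> same X Y"
  by (induction rule: rtrancl_induct) (auto simp: sample_steps_def intro: same_trans)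

text \<open>A nonempty fiber is the image under \<open>tab\<close> of one class of
  \<open>same\<close>, and paths transfer step by step in both directions.\<close>

lemma markov_basis_iff:
  "markov_basis L \<Delta> \<D> M \<longleftrightarrow> finite M \<and> M \<subseteq> moves L \<Delta> \<D> \<and>
     (\<forall>X\<in>S. \<forall>Y\<in>S. same X Y \<longrightarrow> (X, Y) \<in> (sample_steps M)\<^sup>*)"
proof -
  have "(\<forall>b. \<forall>x\<in>fiber L \<Delta> \<D> b. \<forall>y\<in>fiber L \<Delta> \<D> b. (x, y) \<in> (step_rel (fiber L \<Delta> \<D> b) M)\<^sup>*) \<longleftrightarrow>
     (\<forall>X\<in>S. \<forall>Y\<in>S. same X Y \<longrightarrow> (X, Y) \<in> (sample_steps M)\<^sup>*)" (is "?l \<longleftrightarrow> ?r")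
  proof
    assume l: ?l
    show ?r
    proof (intro ballI impI)
      fix X Y assume XY: "X \<in> S" "Y \<in> S" "same X Y"
      let ?F = "fiber L \<Delta> \<D> (marginal_frequencies L \<Delta> \<D> (tab X))"
      have "tab X \<in> ?F" "tab Y \<in> ?F" using XY by (simp_all add: tab_in_fiber_iff)
      then have "(tab X, tab Y) \<in> (step_rel ?F M)\<^sup>*" using l by blast
      \<comment> \<open>The endpoint is left arbitrary so that induction along the path can supply a
        sample for each table visited.\<close>
      moreover have "\<exists>Y\<in>S. y = tab Y \<and> (X, Y) \<in> (sample_steps M)\<^sup>*"
        if "(tab X, y) \<in> (step_rel ?F M)\<^sup>*" for y
        using that
      proof (induction rule: rtrancl_induct)
        case base
        then show ?case using XY by blast
      next
        case (step y y')
        then obtain Y where Y: "Y \<in> S" "y = tab Y" "(X, Y) \<in> (sample_steps M)\<^sup>*" by blast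
        have y': "y' \<in> ?F" using step(2) by (auto simp: step_rel_def)
        then obtain Y' where Y': "Y' \<in> S" "y' = tab Y'"
          by (auto simp: fiber_def tables_eq[OF finite_vars])
        have "same X Y" "same X Y'"
          using sample_steps_star_S[OF Y(3)] XY Y' y' by (auto simp: tab_in_fiber_iff)
        then have "same Y Y'" by (blast intro: same_sym same_trans)
        then have "(Y, Y') \<in> sample_steps M"
          using Y Y' step(2) by (auto simp: sample_steps_def step_rel_def)
        then have "(X, Y') \<in> (sample_steps M)\<^sup>*" using Y(3) by (rule rtrancl_into_rtrancl[rotated])
        then show ?case using Y' by blast
      qed
      ultimately show "(X, Y) \<in> (sample_steps M)\<^sup>*" by force
    qed
  next
    assume r: ?r
    show ?l
    proof (intro allI ballI)
      fix b x y assume xy: "x \<in> fiber L \<Delta> \<D> b" "y \<in> fiber L \<Delta> \<D> b"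
      then obtain X Y where XY: "X \<in> S" "Y \<in> S" "x = tab X" "y = tab Y"
        by (auto simp: fiber_def tables_eq[OF finite_vars])
      have b: "b = marginal_frequencies L \<Delta> \<D> (tab X)" using xy XY by (simp add: fiber_def)
      have "same X Y" using xy XY by (simp add: b tab_in_fiber_iff)
      then have "(X, Y) \<in> (sample_steps M)\<^sup>*" using r XY by blast
      then have "(tab X, tab Y) \<in> (step_rel (fiber L \<Delta> \<D> b) M)\<^sup>*"
      proof (induction rule: rtrancl_induct)
        case base
        then show ?case by simp
      next
        case (step Y Z)
        have Y: "Y \<in> S" "same X Y" using sample_steps_star_S step(1) XY(1) by blast+
        moreover have "Z \<in> S" "same X Z"
          using Y(2) step(2) by (auto simp: sample_steps_def intro: same_trans)
        ultimately have "(tab Y, tab Z) \<in> step_rel (fiber L \<Delta> \<D> b) M"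
          using step(2) XY by (auto simp: b step_rel_def sample_steps_def tab_in_fiber_iff)
        then show ?case using step(3) by simp
      qed
      then show "(x, y) \<in> (step_rel (fiber L \<Delta> \<D> b) M)\<^sup>*" using XY by simp
    qed
  qed
  then show ?thesis by (simp add: markov_basis_def)
qed

lemma markov_basis_connects:
  "markov_basis L \<Delta> \<D> M \<Longrightarrow> X \<in> S \<Longrightarrow> Y \<in> S \<Longrightarrow> same X Y \<Longrightarrow> (X, Y) \<in> (sample_steps M)\<^sup>*"
  by (simp add: markov_basis_iff)

text \<open>Simulating single steps is enough. This serves both to restrict a basis to its quadratic
  moves and to trade a move for a detour.\<close>

lemma markov_basis_replace:
  assumes "markov_basis L \<Delta> \<D> M" "finite M'" "M' \<subseteq> moves L \<Delta> \<D>"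
    and "sample_steps M \<subseteq> (sample_steps M')\<^sup>*"
  shows "markov_basis L \<Delta> \<D> M'"
  using assms rtrancl_subset_rtrancl[OF assms(4)] unfolding markov_basis_iff by blast

text \<open>Markov bases are finite, so descending to smaller ones terminates.\<close>

lemma minimal_markov_basis_below:
  assumes "markov_basis L \<Delta> \<D> M"
  shows "\<exists>M'\<subseteq>M. minimal_markov_basis L \<Delta> \<D> M'"
proof -
  have "finite M" using assms by (simp add: markov_basis_def)
  then show ?thesis
    using assms
  proof (induction M rule: finite_psubset_induct)
    case (psubset M)
    show ?case
    proof (cases "\<exists>M'\<subset>M. markov_basis L \<Delta> \<D> M'")
      case True
      then obtain M' where M': "M' \<subset> M" "markov_basis L \<Delta> \<D> M'" by blast
      from psubset.IH[OF this] show ?thesis using M'(1) by (meson psubset_imp_subset subset_trans)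
    next
      case False
      then show ?thesis using psubset.prems unfolding minimal_markov_basis_def by blast
    qed
  qed
qed

lemma tab_diff_moves:
  assumes "X \<in> S" "Y \<in> S" "same X Y"
  shows "tab Y - tab X \<in> moves L \<Delta> \<D>"
proof -
  have "marginal L \<Delta> D (tab Y - tab X) j = 0" if D: "D \<in> \<D>" "j \<in> cells L D" for D j
  proof -
    have "D \<subseteq> \<Delta>" using D Union_gens by blast
    moreover have "marginal L \<Delta> D (tab Y - tab X) j
        = marginal L \<Delta> D (tab Y) j - marginal L \<Delta> D (tab X) j"
      by (simp add: marginal_def sum_subtractf)
    ultimately show ?thesis
      using assms D by (simp add: marginal_tab finite_vars same_margins_def)
  qed
  moreover have "tab Y - tab X \<in> arrays L \<Delta>"
  proof -
    have "count X i = 0" "count Y i = 0" if "i \<notin> cells L \<Delta>" for i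
      using that assms(1,2) by (metis samplesD not_in_iff)+
    then show ?thesis by (simp add: arrays_def tab_def)
  qed
  ultimately show ?thesis by (auto simp: moves_def)
qed

section \<open>Tables with two counts and quadratic moves\<close>

text \<open>After cancelling \<open>p\<close>, the margins fix the remaining cell on every
  generator, and the generators cover all variables. Hence distinct tables with two counts in a
  common fiber have disjoint supports.\<close>

lemma size_2_share_cell:
  assumes "X \<in> S" "Y \<in> S" "same X Y" "size X = 2" "p \<in># X" "p \<in># Y"
  shows "X = Y"
proof -
  obtain q where X: "X = {#p, q#}"
    using assms(4,5) by (rule size_2_mset_contains)
  have "size Y = 2" using assms same_size by metis
  then obtain q' where Y: "Y = {#p, q'#}"
    using assms(6) by (rule size_2_mset_contains)
  have "q = q'"
  proof (rule cells_eqI)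
    show "q \<in> cells L \<Delta>" "q' \<in> cells L \<Delta>" using X Y assms by auto
    fix v assume "v \<in> \<Delta>"
    then obtain D where "D \<in> \<D>" "v \<in> D" using Union_gens by blast
    then show "q v = q' v"
      using assms(3) X Y by (auto simp: same_margins_def restrict_eq_iff)
  qed
  then show ?thesis using X Y by simp
qed

text \<open>Disjointness makes \<open>X\<close> exactly the negative part of the difference, so
  \<open>U\<close> must contain \<open>X\<close>.\<close>

lemma step_disjoint:
  assumes "X \<inter># Y = {#}" "tab V - tab U = tab Y - tab X"
  shows "\<exists>T. U = T + X \<and> V = T + Y"
proof -
  have *: "int (count V i) - int (count U i) = int (count Y i) - int (count X i)" for i
    using assms(2) by (simp add: tab_def fun_eq_iff)
  have 0: "min (count X i) (count Y i) = 0" for i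
    using assms(1) by (metis count_empty count_inter_mset)
  have le: "count X i \<le> count U i" for i
    using *[of i] 0[of i] by (auto simp: min_def split: if_splits)
  have "count U i = count (U - X + X) i \<and> count V i = count (U - X + Y) i" for i
    using *[of i] le[of i] by auto
  then have "U = (U - X) + X" "V = (U - X) + Y"
    unfolding multiset_eq_iff by blast+
  then show ?thesis by blast
qed

lemma quadratic_movesE:
  assumes "z \<in> quadratic_moves"
  obtains X Y where "X \<in> S" "Y \<in> S" "size X = 2" "size Y = 2" "same X Y" "X \<noteq> Y"
    "z = tab Y - tab X"
proof -
  obtain X Y where XY: "X \<in> S" "Y \<in> S" "size X = 2" "same X Y" "X \<noteq> Y" "z = tab Y - tab X"
    using assms by (auto simp: quadratic_moves_def)
  moreover have "size Y = 2" using same_size[OF XY(4)] XY(3) by simp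
  ultimately show ?thesis using that by blast
qed

lemma quadratic_moves_uminus: "z \<in> quadratic_moves \<Longrightarrow> - z \<in> quadratic_moves"
  by (erule quadratic_movesE)
     (force simp: quadratic_moves_def fun_eq_iff intro: same_sym)

lemma finite_quadratic_moves: "finite quadratic_moves"
proof (rule finite_subset)
  let ?P = "(\<lambda>(p, q). {#p, q#}) ` (cells L \<Delta> \<times> cells L \<Delta>)"
  show "finite ((\<lambda>(X, Y). tab Y - tab X) ` (?P \<times> ?P))"
    using finite_vars by simp
  have P: "X \<in> ?P" if X: "X \<in> S" "size X = 2" for X
  proof -
    obtain p q where "X = {#p, q#}" using size_2_mset[OF X(2)] by blast
    moreover from this have "p \<in> cells L \<Delta>" "q \<in> cells L \<Delta>" using X(1) by auto
    ultimately show ?thesis by (auto intro!: image_eqI[of _ _ "(p, q)"])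
  qed
  show "quadratic_moves \<subseteq> (\<lambda>(X, Y). tab Y - tab X) ` (?P \<times> ?P)"
  proof
    fix z assume "z \<in> quadratic_moves"
    then show "z \<in> (\<lambda>(X, Y). tab Y - tab X) ` (?P \<times> ?P)"
      by (rule quadratic_movesE) (use P in force)
  qed
qed

text \<open>The common part of a swap cancels in the difference of the two tables, so each
  nontrivial swap is a step by a quadratic move.\<close>

lemma quadratic_moves_markov_basis:
  assumes conn: "\<And>X Y. X \<in> S \<Longrightarrow> Y \<in> S \<Longrightarrow> same X Y \<Longrightarrow> (X, Y) \<in> (swaps L \<Delta> \<D>)\<^sup>*"
  shows "markov_basis L \<Delta> \<D> quadratic_moves"
proof -
  have "(U, V) \<in> (sample_steps quadratic_moves)\<^sup>*" if UV: "(U, V) \<in> swaps L \<Delta> \<D>" for U V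
  proof -
    obtain T X Y where T: "U = T + X" "V = T + Y" "U \<in> S" "V \<in> S" "size X = 2" "same X Y"
      using UV unfolding swaps_def by blast
    show ?thesis
    proof (cases "X = Y")
      case False
      then have "tab Y - tab X \<in> quadratic_moves" using T by (auto simp: quadratic_moves_def)
      moreover have "tab V - tab U = tab Y - tab X" by (simp add: T tab_def fun_eq_iff)
      moreover have "same U V" using T by (simp add: same_margins_def)
      ultimately have "(U, V) \<in> sample_steps quadratic_moves"
        using T by (auto simp: sample_steps_def)
      then show ?thesis by blast
    qed (use T in simp)
  qed
  then have "(swaps L \<Delta> \<D>)\<^sup>* \<subseteq> (sample_steps quadratic_moves)\<^sup>*"
    by (intro rtrancl_subset_rtrancl) auto
  moreover have "quadratic_moves \<subseteq> moves L \<Delta> \<D>"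
    by (auto simp: quadratic_moves_def intro: tab_diff_moves)
  ultimately show ?thesis
    using conn finite_quadratic_moves by (auto simp: markov_basis_iff)
qed

section \<open>Uniqueness when two cliques cover the variables\<close>

text \<open>For \<open>X = {#p, q#}\<close>, any other table of the fiber has a cell with the
  \<open>D\<close>-part of \<open>p\<close>. Its \<open>D'\<close>-part cannot be that of
  \<open>p\<close>, since then \<open>p\<close> would be shared with \<open>X\<close>; so it is that
  of \<open>q\<close>. This hybrid cell is unique, and sharing it makes \<open>Y\<close> and
  \<open>Z\<close> equal.\<close>

lemma two_block_fiber:
  assumes D: "D \<in> \<D>" "D' \<in> \<D>" "\<Delta> = D \<union> D'"
    and X: "X \<in> S" "size X = 2"
    and Y: "Y \<in> S" "same X Y" "Y \<noteq> X" and Z: "Z \<in> S" "same X Z" "Z \<noteq> X"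
  shows "Y = Z"
proof -
  obtain p q where pq: "X = {#p, q#}" using X(2) size_2_mset by blast
  have ex: "\<exists>r. r \<in># W \<and> restrict r D = restrict p D \<and> restrict r D' = restrict q D'"
    if W: "W \<in> S" "same X W" "W \<noteq> X" for W
  proof -
    have "proj D W = proj D X" using W D(1) by (simp add: same_margins_def)
    then have "restrict p D \<in># proj D W" by (simp add: pq)
    then obtain r where r: "r \<in># W" "restrict r D = restrict p D" by (auto simp: proj_def)
    then have "restrict r D' \<in># proj D' X" using W D(2) by (auto simp: same_margins_def proj_def)
    then have "restrict r D' = restrict p D' \<or> restrict r D' = restrict q D'" by (auto simp: pq)
    moreover have "restrict r D' \<noteq> restrict p D'"
    proof
      assume "restrict r D' = restrict p D'"
      then have "r = p"
        using r W(1) X(1) pq D(3)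
        by (intro cells_eqI[of r L \<Delta> p]) (auto simp: restrict_eq_iff dest: samplesD)
      then have "X = W"
        using size_2_share_cell[OF X(1) W(1,2) X(2), of p] r(1) pq by simp
      then show False using W by simp
    qed
    ultimately show ?thesis using r by blast
  qed
  obtain r s where r: "r \<in># Y" "restrict r D = restrict p D" "restrict r D' = restrict q D'"
    and s: "s \<in># Z" "restrict s D = restrict p D" "restrict s D' = restrict q D'"
    using ex[OF Y] ex[OF Z] by blast
  have "r = s"
    using r s Y(1) Z(1) D(3)
    by (intro cells_eqI[of r L \<Delta> s]) (auto simp: restrict_eq_iff dest: samplesD)
  moreover have "same Y Z" using Y Z same_sym same_trans by blast
  moreover have "size Y = 2" using Y X same_size by metis
  ultimately show ?thesis using size_2_share_cell Y Z r s by blast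
qed

text \<open>The fiber is just \<open>{X, Y}\<close>, so any path between the two tables must contain
  the direct step.\<close>

lemma two_block_move_forced:
  assumes D: "D \<in> \<D>" "D' \<in> \<D>" "\<Delta> = D \<union> D'"
    and M: "markov_basis L \<Delta> \<D> M" and z: "z \<in> quadratic_moves"
  shows "z \<in> M \<or> - z \<in> M"
proof -
  obtain X Y where XY: "X \<in> S" "Y \<in> S" "size X = 2" "same X Y" "X \<noteq> Y" "z = tab Y - tab X"
    using z by (rule quadratic_movesE)
  have "(X, Y) \<in> (sample_steps M)\<^sup>*" using M XY by (simp add: markov_basis_connects)
  moreover have "W = X \<or> (X, Y) \<in> sample_steps M" if "(X, W) \<in> (sample_steps M)\<^sup>*" for W
    using that
  proof (induction rule: rtrancl_induct)
    case (step U W)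
    have W: "W \<in> S \<and> same X W"
      using sample_steps_star_S[OF rtrancl_into_rtrancl[OF step(1,2)] XY(1)] .
    have "W = X \<or> W = Y"
      using two_block_fiber[OF D XY(1,3,2,4) _ _ _, of W] XY(5) W by blast
    then show ?case using step by blast
  qed simp
  ultimately have "(X, Y) \<in> sample_steps M" using XY(5) by blast
  then obtain u where "u \<in> M" "z = u \<or> z = - u" by (auto simp: sample_steps_def XY(6))
  then show ?thesis by auto
qed

text \<open>The quadratic moves form a Markov basis, and each of them is forced up to sign in every
  other one. A minimal basis therefore consists of the quadratic moves up to sign.\<close>

lemma unique_minimal_markov_basis:
  assumes D: "D \<in> \<D>" "D' \<in> \<D>" "\<Delta> = D \<union> D'"
    and conn: "\<And>X Y. X \<in> S \<Longrightarrow> Y \<in> S \<Longrightarrow> same X Y \<Longrightarrow> (X, Y) \<in> (swaps L \<Delta> \<D>)\<^sup>*"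
  shows "\<exists>!B. \<exists>M. minimal_markov_basis L \<Delta> \<D> M \<and> B = up_to_sign M"
proof -
  have Q: "markov_basis L \<Delta> \<D> quadratic_moves"
    using conn by (rule quadratic_moves_markov_basis)
  have eq: "up_to_sign M = up_to_sign quadratic_moves" if M: "minimal_markov_basis L \<Delta> \<D> M" for M
  proof -
    have mb: "markov_basis L \<Delta> \<D> M" using M by (simp add: minimal_markov_basis_def)
    have forced: "z \<in> M \<or> - z \<in> M" if "z \<in> quadratic_moves" for z
      using two_block_move_forced[OF D mb that] .
    \<comment> \<open>The quadratic moves in \<open>M\<close> simulate all the others, so minimality
      leaves no further move in \<open>M\<close>.\<close>
    have "sample_steps quadratic_moves \<subseteq> sample_steps (M \<inter> quadratic_moves)"
    proof (intro subrelI)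
      fix U V assume "(U, V) \<in> sample_steps quadratic_moves"
      then obtain z where z: "U \<in> S" "V \<in> S" "same U V" "z \<in> quadratic_moves"
        "tab V - tab U = z \<or> tab V - tab U = - z"
        by (auto simp: sample_steps_def)
      then have "z \<in> M \<inter> quadratic_moves \<or> - z \<in> M \<inter> quadratic_moves"
        using forced quadratic_moves_uminus by blast
      moreover have "tab V - tab U = z \<or> tab V - tab U = - z"
        "tab V - tab U = - z \<or> tab V - tab U = - (- z)"
        using z(5) by auto
      ultimately show "(U, V) \<in> sample_steps (M \<inter> quadratic_moves)"
        unfolding sample_steps_def using z(1-3) by blast
    qed
    moreover have "M \<subseteq> moves L \<Delta> \<D>" "finite M" using mb by (auto simp: markov_basis_def)
    ultimately have "markov_basis L \<Delta> \<D> (M \<inter> quadratic_moves)"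
      using markov_basis_replace[OF Q] by (metis finite_Int le_infI1 r_into_rtrancl subset_iff subrelI)
    then have sub: "M \<subseteq> quadratic_moves"
      using M unfolding minimal_markov_basis_def by blast
    show ?thesis
    proof
      show "up_to_sign M \<subseteq> up_to_sign quadratic_moves" using sub by (auto simp: up_to_sign_def)
      show "up_to_sign quadratic_moves \<subseteq> up_to_sign M"
      proof
        fix B assume "B \<in> up_to_sign quadratic_moves"
        then obtain z where z: "z \<in> quadratic_moves" "B = {z, - z}" by (auto simp: up_to_sign_def)
        then have "B = {- z, - (- z)}" by auto
        then show "B \<in> up_to_sign M"
          using forced[OF z(1)] z(2) unfolding up_to_sign_def by blast
      qed
    qed
  qed
  obtain M where "minimal_markov_basis L \<Delta> \<D> M"
    using minimal_markov_basis_below[OF Q] by blast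
  then show ?thesis using eq by (intro ex1I[of _ "up_to_sign quadratic_moves"]) auto
qed

section \<open>Non-uniqueness from a fiber with three tables\<close>

text \<open>In a fiber of three samples a step \<open>X \<rightarrow> Y\<close> of a Markov basis can be replaced by the detour
  through a third sample \<open>W\<close>.\<close>

lemma not_unique_minimal_markov_basis:
  assumes "A1 \<in> S" "A2 \<in> S" "A3 \<in> S" "size A1 = 2" "same A1 A2" "same A1 A3"
    and "A1 \<noteq> A2" "A1 \<noteq> A3" "A2 \<noteq> A3"
  shows "\<not> (\<exists>!B. \<exists>M. minimal_markov_basis L \<Delta> \<D> M \<and> B = up_to_sign M)"
proof
  assume uniq: "\<exists>!B. \<exists>M. minimal_markov_basis L \<Delta> \<D> M \<and> B = up_to_sign M"
  then obtain M where M: "minimal_markov_basis L \<Delta> \<D> M" by blast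
  have mb: "markov_basis L \<Delta> \<D> M" using M by (simp add: minimal_markov_basis_def)
  have "(A1, A2) \<in> (sample_steps M)\<^sup>*" using mb assms by (simp add: markov_basis_connects)
  \<comment> \<open>The first step of the path that really leaves \<open>A1\<close> supplies the
    move to be traded.\<close>
  moreover have "W = A1 \<or> (\<exists>Y. Y \<noteq> A1 \<and> (A1, Y) \<in> sample_steps M)"
    if "(A1, W) \<in> (sample_steps M)\<^sup>*" for W
    using that by (induction rule: rtrancl_induct) auto
  ultimately obtain Y where Y: "Y \<noteq> A1" "(A1, Y) \<in> sample_steps M" using assms by blast
  define X where "X = A1"
  obtain W where W: "W \<in> S" "same X W" "W \<noteq> X" "W \<noteq> Y"
    using assms by (cases "Y = A2") (auto simp: X_def)
  have XY: "X \<in> S" "Y \<in> S" "same X Y" "X \<noteq> Y" "size X = 2"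
    using Y assms by (auto simp: X_def sample_steps_def)
  have sz: "size Y = 2" "size W = 2" using XY W same_size by metis+
  have WY: "same W Y" using W(2) XY(3) same_sym same_trans by blast
  obtain z where z: "z \<in> M" "tab Y - tab X = z \<or> tab Y - tab X = - z"
    using Y(2) by (auto simp: X_def sample_steps_def)
  define M' where "M' = M - {z, - z} \<union> {tab W - tab X, tab Y - tab W}"
  have disj: "P \<inter># Q = {#}"
    if "P \<in> S" "Q \<in> S" "same P Q" "size P = 2" "P \<noteq> Q" for P Q
    using size_2_share_cell[OF that(1-4)] that(5) by (metis IntE multiset_nonemptyE set_mset_inter)
  have cnt: "count P i = 0 \<or> count Q i = 0" if "P \<inter># Q = {#}"
    for P Q :: "(nat \<Rightarrow> nat) multiset" and i
    using that by (metis count_empty count_inter_mset min_def)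
  have dXY: "X \<inter># Y = {#}" and dXW: "X \<inter># W = {#}" and dWY: "W \<inter># Y = {#}"
    using disj XY W WY sz by auto
  have dYX: "Y \<inter># X = {#}" using dXY by (simp add: multiset_eq_iff min.commute)
  \<comment> \<open>The cell \<open>x\<close> occurs only in \<open>X\<close> and \<open>y\<close>
    only in \<open>Y\<close>, never in \<open>W\<close>; evaluation at these cells separates the
    detour moves from \<open>z\<close> and \<open>- z\<close>.\<close>
  obtain x y where xy: "x \<in># X" "y \<in># Y" using XY sz by (metis multiset_nonemptyE size_empty zero_neq_numeral)
  have cx: "count X x > 0" "count Y x = 0" "count W x = 0"
    using xy cnt[OF dXY, of x] cnt[OF dXW, of x] by (auto simp: count_eq_zero_iff)
  have cy: "count Y y > 0" "count X y = 0" "count W y = 0"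
    using xy cnt[OF dXY, of y] cnt[OF dWY, of y] by (auto simp: count_eq_zero_iff)
  have "z = tab Y - tab X \<or> z = tab X - tab Y" using z(2) by (metis minus_diff_eq minus_minus)
  then have zz: "{z, - z} = {tab Y - tab X, tab X - tab Y}" by auto
  have nz: "tab W - tab X \<notin> {z, - z}" "tab Y - tab W \<notin> {z, - z}"
  proof -
    have "(tab W - tab X) y \<noteq> (tab Y - tab X) y" "(tab W - tab X) x \<noteq> (tab X - tab Y) x"
      "(tab Y - tab W) x \<noteq> (tab Y - tab X) x" "(tab Y - tab W) y \<noteq> (tab X - tab Y) y"
      using cx cy by (simp_all add: tab_def)
    then show "tab W - tab X \<notin> {z, - z}" "tab Y - tab W \<notin> {z, - z}"
      unfolding zz by (metis empty_iff insert_iff)+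
  qed
  have "sample_steps M \<subseteq> (sample_steps M')\<^sup>*"
  proof (intro subrelI)
    fix U V assume UV: "(U, V) \<in> sample_steps M"
    then obtain z' where z': "U \<in> S" "V \<in> S" "z' \<in> M" "tab V - tab U = z' \<or> tab V - tab U = - z'"
      by (auto simp: sample_steps_def)
    have detour: "(T + X, T + Y) \<in> (sample_steps M')\<^sup>*" "(T + Y, T + X) \<in> (sample_steps M')\<^sup>*"
      if T: "T \<in> S" for T
    proof -
      have "(T + X, T + W) \<in> sample_steps M'" "(T + W, T + Y) \<in> sample_steps M'"
        "(T + Y, T + W) \<in> sample_steps M'" "(T + W, T + X) \<in> sample_steps M'"
        using T XY W WY by (auto simp: sample_steps_def M'_def tab_def fun_eq_iff same_margins_def)
      then show "(T + X, T + Y) \<in> (sample_steps M')\<^sup>*" "(T + Y, T + X) \<in> (sample_steps M')\<^sup>*"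
        by (meson converse_rtrancl_into_rtrancl r_into_rtrancl)+
    qed
    show "(U, V) \<in> (sample_steps M')\<^sup>*"
    proof (cases "z' \<in> {z, - z}")
      case True
      then have "z' = tab Y - tab X \<or> z' = tab X - tab Y" by (simp add: zz)
      then have "tab V - tab U = tab Y - tab X \<or> tab V - tab U = tab X - tab Y"
        using z'(4) by (metis minus_diff_eq)
      then show ?thesis
      proof
        assume "tab V - tab U = tab Y - tab X"
        from step_disjoint[OF dXY this] show ?thesis using detour z' by auto
      next
        assume "tab V - tab U = tab X - tab Y"
        from step_disjoint[OF dYX this] show ?thesis using detour z' by auto
      qed
    next
      case False
      then have "(U, V) \<in> sample_steps M'"
        using UV z' by (auto simp: sample_steps_def M'_def)
      then show ?thesis by blast
    qed
  qed
  moreover have "finite M'" "M' \<subseteq> moves L \<Delta> \<D>"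
    using mb tab_diff_moves[of X W] tab_diff_moves[of W Y] XY W WY
    by (auto simp: M'_def markov_basis_def)
  ultimately have "markov_basis L \<Delta> \<D> M'" using markov_basis_replace[OF mb] by blast
  then obtain M'' where M'': "M'' \<subseteq> M'" "minimal_markov_basis L \<Delta> \<D> M''"
    using minimal_markov_basis_below by blast
  \<comment> \<open>Uniqueness would put \<open>z\<close> or \<open>- z\<close> into
    \<open>M''\<close>, but \<open>M'\<close> contains neither.\<close>
  then have "up_to_sign M'' = up_to_sign M" using uniq M by blast
  then have "{z, - z} \<in> up_to_sign M''" using z(1) by (auto simp: up_to_sign_def)
  then obtain u where "u \<in> M''" "{u, - u} = {z, - z}" by (auto simp: up_to_sign_def)
  then have "u \<in> M'" "u \<in> {z, - z}" using M'' by blast+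
  then show False using nz by (auto simp: M'_def)
qed

text \<open>Consider pairs of cells with complementary 0/1 patterns on \<open>{a, b, c}\<close> and
  level 0 elsewhere. A generator meets the triple in at most one vertex, so it sees only one 0 and
  one 1 there, whichever patterns are used. Three of these pairs give three tables in one
  fiber.\<close>

lemma independent_triple_not_unique:
  assumes lev: "\<And>v. v \<in> \<Delta> \<Longrightarrow> 2 \<le> L v"
    and abc: "a \<in> \<Delta>" "b \<in> \<Delta>" "c \<in> \<Delta>" "a \<noteq> b" "a \<noteq> c" "b \<noteq> c"
    and ind: "\<And>D. D \<in> \<D> \<Longrightarrow> \<not> {a, b} \<subseteq> D \<and> \<not> {a, c} \<subseteq> D \<and> \<not> {b, c} \<subseteq> D"
  shows "\<not> (\<exists>!B. \<exists>M. minimal_markov_basis L \<Delta> \<D> M \<and> B = up_to_sign M)"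
proof -
  define e where "e T = (\<lambda>v\<in>\<Delta>. if v \<in> T then 1 else 0 :: nat)" for T
  have e: "e T \<in> cells L \<Delta>" for T
    using lev by (force simp: e_def cells_def)
  have e_eq: "e T = e T' \<longleftrightarrow> T \<inter> \<Delta> = T' \<inter> \<Delta>" for T T'
    by (auto simp: e_def fun_eq_iff restrict_def split: if_splits)
  have eD: "restrict (e T) D = restrict (e T') D \<longleftrightarrow> T \<inter> D = T' \<inter> D" if "D \<in> \<D>" for T T' D
    using that Union_gens by (auto simp: e_def restrict_eq_iff split: if_splits)
  let ?A = "\<lambda>T. {#e T, e ({a, b, c} - T)#}"
  have same: "same (?A {}) (?A {d})" if d: "d \<in> {a, b, c}" for d
    unfolding same_margins_def
  proof
    fix D assume D: "D \<in> \<D>"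
    show "proj D (?A {}) = proj D (?A {d})"
      unfolding proj_simps mset_pair_eq eD[OF D]
      using ind[OF D] abc d by blast
  qed
  show ?thesis
  proof (rule not_unique_minimal_markov_basis)
    show "?A {} \<in> S" "?A {a} \<in> S" "?A {b} \<in> S" using e by auto
    show "same (?A {}) (?A {a})" "same (?A {}) (?A {b})" by (rule same, simp)+
    show "?A {} \<noteq> ?A {a}" "?A {} \<noteq> ?A {b}" "?A {a} \<noteq> ?A {b}"
      unfolding mset_pair_eq e_eq using abc by auto
  qed simp
qed

end

section \<open>Chordal graphs without independent triples\<close>

text \<open>The only distinct positions of a list of length four that are not cyclically consecutive
  are the two diagonals; irreflexivity excludes equal positions.\<close>

lemma chordal_4_cycle:
  assumes "chordal V E" and sym: "\<And>u v. E u v \<Longrightarrow> E v u" and irr: "\<And>u. \<not> E u u"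
    and "{a, b, c, d} \<subseteq> V" "distinct [a, b, c, d]" "E a b" "E b c" "E c d" "E d a"
  shows "E a c \<or> E b d"
proof -
  have "is_cycle V E [a, b, c, d]"
    using assms by (simp add: is_cycle_def All_less_Suc)
  then have "has_chord E [a, b, c, d]"
    using assms(1) by (simp add: chordal_def)
  then show ?thesis
    using irr sym by (auto simp: has_chord_def Ex_less_Suc)
qed

lemma chordal_5_cycle:
  assumes "chordal V E" and sym: "\<And>u v. E u v \<Longrightarrow> E v u" and irr: "\<And>u. \<not> E u u"
    and "{a, b, c, d, e} \<subseteq> V" "distinct [a, b, c, d, e]" "E a b" "E b c" "E c d" "E d e" "E e a"
  shows "E a c \<or> E a d \<or> E b d \<or> E b e \<or> E c e"
proof -
  have "is_cycle V E [a, b, c, d, e]"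
    using assms by (simp add: is_cycle_def All_less_Suc)
  then have "has_chord E [a, b, c, d, e]"
    using assms(1) by (simp add: chordal_def)
  then show ?thesis
    using irr sym by (auto simp: has_chord_def Ex_less_Suc)
qed

text \<open>The independence number is at most two.\<close>

definition no_independent_triple :: "nat set \<Rightarrow> (nat \<Rightarrow> nat \<Rightarrow> bool) \<Rightarrow> bool" where
  "no_independent_triple V E \<longleftrightarrow> (\<forall>a\<in>V. \<forall>b\<in>V. \<forall>c\<in>V.
     a \<noteq> b \<and> a \<noteq> c \<and> b \<noteq> c \<longrightarrow> E a b \<or> E a c \<or> E b c)"

lemma no_independent_tripleD:
  "no_independent_triple V E \<Longrightarrow> a \<in> V \<Longrightarrow> b \<in> V \<Longrightarrow> c \<in> V \<Longrightarrow> a \<noteq> b \<Longrightarrow> a \<noteq> c \<Longrightarrow> b \<noteq> c \<Longrightarrow>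
    E a b \<or> E a c \<or> E b c"
  by (simp add: no_independent_triple_def)

text \<open>Without induced 4- and 5-cycles, the sets of common neighbours of \<open>t\<close> with its
  non-neighbours are nested; a non-neighbour for which this set is minimal is simplicial.\<close>

lemma simplicial_non_neighbour:
  assumes ch: "chordal V E" and sym: "\<And>u v. E u v \<Longrightarrow> E v u" and irr: "\<And>u. \<not> E u u"
    and W: "W \<subseteq> V" "finite W" "no_independent_triple W E"
    and t: "t \<in> W" and u: "u \<in> W" "u \<noteq> t" "\<not> E t u"
  shows "\<exists>s\<in>W. s \<noteq> t \<and> \<not> E t s \<and> simplicial_vertex W E s"
proof -
  define N where "N = {s \<in> W. s \<noteq> t \<and> \<not> E t s}"
  define C where "C s = {v \<in> W. E s v \<and> E t v}" for s
  have "u \<in> N" using u by (simp add: N_def)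
  then obtain s where s: "s \<in> N" and min: "\<And>s'. s' \<in> N \<Longrightarrow> card (C s) \<le> card (C s')"
    using ex_has_least_nat[of "\<lambda>s. s \<in> N" u "\<lambda>s. card (C s)"] by blast
  have N_clique: "E x y" if "x \<in> N" "y \<in> N" "x \<noteq> y" for x y
    using no_independent_tripleD[OF W(3) t, of x y] that by (auto simp: N_def)
  have nested: "C x \<subseteq> C y \<or> C y \<subseteq> C x" if xy: "x \<in> N" "y \<in> N" for x y
  proof (rule ccontr)
    assume "\<not> ?thesis"
    then obtain p q where p: "p \<in> C x" "p \<notin> C y" and q: "q \<in> C y" "q \<notin> C x" by blast
    then have pq: "p \<in> V" "q \<in> V" "E x p" "E t p" "\<not> E y p" "E y q" "E t q" "\<not> E x q" "p \<noteq> q"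
      using W(1) by (auto simp: C_def)
    have xy': "x \<in> V" "y \<in> V" "t \<in> V" "\<not> E t x" "\<not> E t y" "x \<noteq> t" "y \<noteq> t" "x \<noteq> y" "E x y"
      using xy W(1) t N_clique[OF xy] p q by (auto simp: N_def)
    have ne: "p \<noteq> x" "p \<noteq> y" "q \<noteq> x" "q \<noteq> y" "p \<noteq> t" "q \<noteq> t"
      using pq xy' irr sym by metis+
    show False
    \<comment> \<open>If \<open>p\<close> and \<open>q\<close> are adjacent, then
      \<open>x, y, q, p\<close> is a chordless 4-cycle; otherwise \<open>t, p, x, y, q\<close> is a
      chordless 5-cycle.\<close>
    proof (cases "E p q")
      case True
      have "E x q \<or> E y p"
        by (rule chordal_4_cycle[OF ch sym irr, of x y q p])
          (use pq xy' ne sym True in auto)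
      then show False using pq by blast
    next
      case False
      have "E t x \<or> E t y \<or> E p y \<or> E p q \<or> E x q"
        by (rule chordal_5_cycle[OF ch sym irr, of t p x y q])
          (use pq xy' ne sym in auto)
      then show False using pq xy' False sym by blast
    qed
  qed
  have sub: "C s \<subseteq> C s'" if "s' \<in> N" for s'
  proof -
    have "finite (C s)" using W(2) by (simp add: C_def)
    then show ?thesis using nested[OF s that] min[OF that] card_seteq by blast
  qed
  have "simplicial_vertex W E s"
    unfolding simplicial_vertex_def
  proof (intro conjI ballI impI)
    show "s \<in> W" using s by (simp add: N_def)
    fix x y assume xy: "x \<in> W" "y \<in> W" "E s x \<and> E s y \<and> x \<noteq> y"
    have st: "s \<noteq> t" "\<not> E t s" "s \<in> V" "t \<in> V" using s W(1) t by (auto simp: N_def)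
    \<comment> \<open>Neighbours of \<open>s\<close> are of two kinds: two in \<open>N\<close> are
      adjacent because \<open>N\<close> is a clique, and mixed pairs are adjacent because
      \<open>C s\<close> is the smallest set of its kind.\<close>
    have split: "v \<in> N \<or> v \<in> C s" if "v \<in> W" "E s v" for v
      using that st sym by (auto simp: N_def C_def)
    consider "x \<in> N" "y \<in> N" | "x \<in> N" "y \<in> C s" | "x \<in> C s" "y \<in> N" | "x \<in> C s" "y \<in> C s"
      using split xy by blast
    then show "E x y"
    proof cases
      case 1
      then show ?thesis using N_clique xy by blast
    next
      case 2
      then show ?thesis using sub[OF 2(1)] by (auto simp: C_def)
    next
      case 3
      then show ?thesis using sub[OF 3(2)] sym by (auto simp: C_def)
    next
      \<comment> \<open>The 4-cycle \<open>s, x, t, y\<close> lacks the chord from \<open>s\<close>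
        to \<open>t\<close>, so it has the other one.\<close>
      case 4
      then have "x \<in> V" "y \<in> V" "E s x" "E x t" "E t y" "E y s"
        using W(1) sym by (auto simp: C_def)
      moreover from this have "distinct [s, x, t, y]" using st xy irr by auto
      ultimately have "E s t \<or> E x y"
        using st by (intro chordal_4_cycle[OF ch sym irr]) auto
      then show ?thesis using st sym by blast
    qed
  qed
  then show ?thesis using s by (auto simp: N_def)
qed

lemma maximal_cliques_eq:
  "maximal_cliques V E = {C \<in> cliques V E. \<forall>C'\<in>cliques V E. C \<subseteq> C' \<longrightarrow> C' = C}"
  unfolding maximal_cliques_def cliques_def Let_def by blast

section \<open>Boundary cliques of decomposable models\<close>

locale decomposable_model = contingency_model +
  assumes decomp: "decomposable \<Delta> \<D>"
begin

abbreviation "E \<equiv> independence_graph \<D>"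

lemma E_sym: "E u v \<Longrightarrow> E v u"
  by (auto simp: independence_graph_def)

lemma E_irrefl: "\<not> E u u"
  by (simp add: independence_graph_def)

lemma chordal_E: "chordal \<Delta> E"
  using decomp by (simp add: decomposable_def)

lemma gens_iff: "D \<in> \<D> \<longleftrightarrow> D \<in> cliques \<Delta> E \<and> (\<forall>C\<in>cliques \<Delta> E. D \<subseteq> C \<longrightarrow> C = D)"
proof -
  have "\<D> = maximal_cliques \<Delta> E" using decomp by (simp add: decomposable_def)
  then have "D \<in> \<D> \<longleftrightarrow> D \<in> maximal_cliques \<Delta> E" by (rule arg_cong)
  then show ?thesis by (simp add: maximal_cliques_eq)
qed

lemma gens_clique: "D \<in> \<D> \<Longrightarrow> D \<in> cliques \<Delta> E"
  and gens_maximal: "D \<in> \<D> \<Longrightarrow> C \<in> cliques \<Delta> E \<Longrightarrow> D \<subseteq> C \<Longrightarrow> C = D"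
  using gens_iff by blast+

lemma gens_adjacent: "D \<in> \<D> \<Longrightarrow> u \<in> D \<Longrightarrow> v \<in> D \<Longrightarrow> u \<noteq> v \<Longrightarrow> E u v"
  by (auto simp: independence_graph_def)

lemma clique_extends:
  assumes "C \<in> cliques \<Delta> E"
  shows "\<exists>D\<in>\<D>. C \<subseteq> D"
proof -
  have "finite (cliques \<Delta> E)"
  proof (rule finite_subset)
    show "cliques \<Delta> E \<subseteq> Pow \<Delta>" by (auto simp: cliques_def)
    show "finite (Pow \<Delta>)" using finite_vars by simp
  qed
  from finite_has_maximal2[OF this assms] show ?thesis
    using gens_iff by metis
qed

text \<open>Each clique lies in a generator, and its margin is a margin of the margin there.\<close>

lemma same_margins_cliques: "same_margins (cliques \<Delta> E) X Y \<longleftrightarrow> same X Y"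
proof
  show "same X Y" if "same_margins (cliques \<Delta> E) X Y"
    using that gens_clique by (auto simp: same_margins_def)
  show "same_margins (cliques \<Delta> E) X Y" if XY: "same X Y"
    unfolding same_margins_def
  proof
    fix C assume "C \<in> cliques \<Delta> E"
    then obtain D where "D \<in> \<D>" "C \<inter> D = C" using clique_extends by blast
    then show "proj C X = proj C Y"
      using XY unfolding same_margins_def by (metis proj_proj)
  qed
qed

text \<open>The closed neighbourhood of a simplicial vertex is a clique containing every clique
  through that vertex, so only one generator contains the vertex.\<close>

lemma simplicial_clique:
  assumes "simplicial_vertex \<Delta> E v" "v \<in> D" "D \<in> \<D>"
  shows "D = insert v {u \<in> \<Delta>. E v u}"
proof -
  have "insert v {u \<in> \<Delta>. E v u} \<in> cliques \<Delta> E"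
    using assms(1) E_sym unfolding cliques_def simplicial_vertex_def by blast
  moreover have "D \<subseteq> insert v {u \<in> \<Delta>. E v u}"
    using assms(2,3) gens_adjacent Union_gens by blast
  ultimately show ?thesis using gens_maximal assms(3) by metis
qed

lemma simplicial_non_neighbour_E:
  assumes "W \<subseteq> \<Delta>" "no_independent_triple W E" "t \<in> W" "u \<in> W" "u \<noteq> t" "\<not> E t u"
  shows "\<exists>s\<in>W. s \<noteq> t \<and> \<not> E t s \<and> simplicial_vertex W E s"
proof (rule simplicial_non_neighbour)
  show "finite W" using assms(1) finite_vars by (rule finite_subset)
qed (fact chordal_E E_irrefl assms | erule E_sym)+

text \<open>Every induced subgraph has a vertex to eliminate: in a complete one any vertex will do,
  and otherwise a non-adjacent pair yields a simplicial vertex.\<close>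

lemma swaps_connect_model:
  assumes alpha: "no_independent_triple \<Delta> E" and XY: "X \<in> S" "Y \<in> S" "same X Y"
  shows "(X, Y) \<in> (swaps L \<Delta> \<D>)\<^sup>*"
proof -
  have "\<exists>v\<in>W. simplicial_vertex W E v" if W: "W \<subseteq> \<Delta>" "W \<noteq> {}" for W
  proof (cases "\<exists>t\<in>W. \<exists>u\<in>W. u \<noteq> t \<and> \<not> E t u")
    case True
    then obtain t u where "t \<in> W" "u \<in> W" "u \<noteq> t" "\<not> E t u" by blast
    moreover have "no_independent_triple W E"
      using alpha W(1) unfolding no_independent_triple_def by (meson subsetD)
    ultimately show ?thesis
      using simplicial_non_neighbour_E[OF W(1)] by blast
  next
    case False
    then have "simplicial_vertex W E v" if "v \<in> W" for v
      using that by (auto simp: simplicial_vertex_def)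
    then show ?thesis using W(2) by blast
  qed
  from swaps_connect[OF finite_vars E_sym E_irrefl this XY(1,2)]
  have "(X, Y) \<in> (swaps L \<Delta> (cliques \<Delta> E))\<^sup>*"
    using XY(3) by (simp add: same_margins_cliques)
  then show ?thesis by (simp add: swaps_def same_margins_cliques)
qed

text \<open>The sets \<open>K w\<close> of neighbours in \<open>D\<close> of the vertices
  \<open>w\<close> outside \<open>D\<close> are nested: all these vertices lie in \<open>D'\<close>,
  so two incomparable sets would give a chordless 4-cycle. The largest one is
  \<open>Sep \<Delta> \<D> D\<close>, and a generator containing it together with \<open>w\<close>
  cuts it out of \<open>D\<close>.\<close>

lemma simplicial_boundary_clique:
  assumes D: "D \<in> \<D>" "D' \<in> \<D>" "\<Delta> = D \<union> D'" "D \<noteq> D'"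
    and s: "s \<in> D" "simplicial_vertex \<Delta> E s"
  shows "D \<in> boundary_cliques \<Delta> \<D>"
proof -
  define K where "K w = {u \<in> D. E w u}" for w
  have "\<not> D' \<subseteq> D" using D(4) gens_maximal[OF D(2) gens_clique[OF D(1)]] by blast
  then obtain w0 where w0: "w0 \<in> \<Delta> - D" using D(3) by blast
  have fin: "finite (K x)" for x using finite_vars D(3) by (simp add: K_def)
  have nested: "K x \<subseteq> K y \<or> K y \<subseteq> K x" if xy: "x \<in> \<Delta> - D" "y \<in> \<Delta> - D" for x y
  proof (rule ccontr)
    assume "\<not> ?thesis"
    then obtain p q where p: "p \<in> K x" "p \<notin> K y" and q: "q \<in> K y" "q \<notin> K x" by blast
    then have pq: "p \<in> D" "q \<in> D" "E x p" "\<not> E y p" "E y q" "\<not> E x q"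
      by (auto simp: K_def)
    then have ne: "p \<noteq> q" "x \<noteq> y" by auto
    have "E x y" using xy D gens_adjacent[OF D(2)] ne by blast
    moreover have "E q p" using gens_adjacent[OF D(1)] pq ne by blast
    ultimately have "E p y \<or> E x q"
      using xy pq ne D(3) E_sym
      by (intro chordal_4_cycle[OF chordal_E E_sym E_irrefl, of p x y q]) auto
    then show False using pq E_sym by blast
  qed
  have "\<exists>w. w \<in> \<Delta> - D \<and> (\<forall>w'. w' \<in> \<Delta> - D \<longrightarrow> card (K w') \<le> card (K w))"
  proof (rule ex_has_greatest_nat)
    show "w0 \<in> \<Delta> - D" by (rule w0)
    have "card (K y) \<le> card D" for y
      using finite_vars D(3) by (intro card_mono) (auto simp: K_def)
    then show "\<forall>y. y \<in> \<Delta> - D \<longrightarrow> card (K y) < Suc (card D)" by (simp add: less_Suc_eq_le)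
  qed
  then obtain w where w: "w \<in> \<Delta> - D" and max: "\<And>w'. w' \<in> \<Delta> - D \<Longrightarrow> card (K w') \<le> card (K w)"
    by blast
  have sub: "K x \<subseteq> K w" if "x \<in> \<Delta> - D" for x
    using nested[OF that w] max[OF that] card_seteq[OF fin] by blast
  \<comment> \<open>A vertex of \<open>D\<close> fails to be simplicial exactly when it has a
    neighbour outside \<open>D\<close>.\<close>
  have Sep: "Sep \<Delta> \<D> D = K w"
  proof
    show "K w \<subseteq> Sep \<Delta> \<D> D"
    proof
      fix v assume v: "v \<in> K w"
      then have "\<not> simplicial_vertex \<Delta> E v"
        using simplicial_clique[of v D] D(1) w E_sym by (auto simp: K_def)
      then show "v \<in> Sep \<Delta> \<D> D" using v by (auto simp: Sep_def Simp_def K_def)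
    qed
    show "Sep \<Delta> \<D> D \<subseteq> K w"
    proof
      fix v assume "v \<in> Sep \<Delta> \<D> D"
      then have v: "v \<in> D" "\<not> simplicial_vertex \<Delta> E v" by (auto simp: Sep_def Simp_def)
      then obtain x where "x \<in> \<Delta> - D" "E v x"
        using D(3) gens_adjacent[OF D(1)] unfolding simplicial_vertex_def by blast
      then show "v \<in> K w" using sub v(1) E_sym by (auto simp: K_def)
    qed
  qed
  have "insert w (K w) \<in> cliques \<Delta> E"
    using w D(3) gens_adjacent[OF D(1)] E_sym by (auto simp: cliques_def K_def)
  then obtain C where C: "C \<in> \<D>" "insert w (K w) \<subseteq> C" using clique_extends by blast
  have "D \<inter> C = K w"
    using C w gens_adjacent[OF C(1), of w] by (auto simp: K_def)
  then have "Sep \<Delta> \<D> D = D \<inter> C" using Sep by simp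
  moreover have "C \<noteq> D" using C(2) w by blast
  moreover have "s \<in> Simp \<Delta> \<D> D" using s by (simp add: Simp_def)
  ultimately show ?thesis using C(1) D(1) by (auto simp: boundary_cliques_def)
qed

text \<open>Looking for a simplicial non-neighbour twice, first of \<open>t\<close> and then of the
  vertex \<open>s\<close> just found, gives two non-adjacent simplicial vertices. Every other vertex
  is adjacent to one of them, so their closed neighbourhoods, which are generators, cover the
  graph.\<close>

lemma boundary_cliques_cover:
  assumes alpha: "no_independent_triple \<Delta> E" and two: "2 \<le> card \<D>"
  shows "\<exists>D D'. D \<noteq> D' \<and> boundary_cliques \<Delta> \<D> = {D, D'} \<and> (\<forall>D''\<in>\<D>. D'' \<subseteq> D \<union> D')"
proof -
  \<comment> \<open>A complete graph would have \<open>\<Delta>\<close> as its only maximal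
    clique.\<close>
  have "\<exists>t\<in>\<Delta>. \<exists>u\<in>\<Delta>. u \<noteq> t \<and> \<not> E t u"
  proof (rule ccontr)
    assume "\<not> ?thesis"
    then have "\<Delta> \<in> cliques \<Delta> E" by (auto simp: cliques_def)
    then have "\<D> \<subseteq> {\<Delta>}" using gens_maximal Union_gens by blast
    then have "card \<D> \<le> 1" using card_mono[of "{\<Delta>}" \<D>] by simp
    then show False using two by simp
  qed
  then obtain t u where tu: "t \<in> \<Delta>" "u \<in> \<Delta>" "u \<noteq> t" "\<not> E t u" by blast
  note ex = simplicial_non_neighbour_E[OF order_refl alpha]
  obtain s where s: "s \<in> \<Delta>" "s \<noteq> t" "\<not> E t s" "simplicial_vertex \<Delta> E s"
    using ex[OF tu] by blast
  obtain s' where s': "s' \<in> \<Delta>" "s' \<noteq> s" "\<not> E s s'" "simplicial_vertex \<Delta> E s'"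
    using ex[OF s(1) tu(1)] s E_sym by blast
  obtain D D' where D: "D \<in> \<D>" "s \<in> D" and D': "D' \<in> \<D>" "s' \<in> D'"
    using s(1) s'(1) Union_gens by blast
  note DN = simplicial_clique[OF s(4) D(2,1)] and DN' = simplicial_clique[OF s'(4) D'(2,1)]
  have ne: "D \<noteq> D'" using s' D D' DN by blast
  have cover: "\<Delta> = D \<union> D'"
  proof
    show "D \<union> D' \<subseteq> \<Delta>" using D D' Union_gens by blast
    show "\<Delta> \<subseteq> D \<union> D'"
    proof
      fix v assume "v \<in> \<Delta>"
      then have "v = s \<or> v = s' \<or> E s v \<or> E s' v"
        using no_independent_tripleD[OF alpha s(1) s'(1), of v] s'(2,3) by blast
      then show "v \<in> D \<union> D'" using D D' DN DN' \<open>v \<in> \<Delta>\<close> by blast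
    qed
  qed
  have "D \<in> boundary_cliques \<Delta> \<D>" "D' \<in> boundary_cliques \<Delta> \<D>"
    using simplicial_boundary_clique[OF D(1) D'(1) cover ne D(2) s(4)]
      simplicial_boundary_clique[OF D'(1) D(1) _ _ D'(2) s'(4)] cover ne by (simp_all add: Un_commute)
  \<comment> \<open>A boundary clique has a simplicial vertex, which lies in \<open>D\<close> or
    \<open>D'\<close> and belongs to a single generator.\<close>
  moreover have "C = D \<or> C = D'" if "C \<in> boundary_cliques \<Delta> \<D>" for C
  proof -
    obtain r where r: "r \<in> C" "C \<in> \<D>" "simplicial_vertex \<Delta> E r"
      using \<open>C \<in> boundary_cliques \<Delta> \<D>\<close> unfolding boundary_cliques_def Simp_def by blast
    then have "r \<in> D \<or> r \<in> D'" using cover Union_gens by blast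
    then show ?thesis
      using simplicial_clique[OF r(3)] r(1,2) D(1) D'(1) by metis
  qed
  ultimately have "boundary_cliques \<Delta> \<D> = {D, D'}" by blast
  then show ?thesis using ne cover Union_gens by blast
qed

end

theorem corollary2:
  fixes m :: nat and L :: "nat \<Rightarrow> nat" and \<Delta> :: "nat set" and \<D> :: "nat set set"
  assumes "\<Delta> = {1..m}"
    and "\<And>\<delta>. \<delta> \<in> \<Delta> \<Longrightarrow> 2 \<le> L \<delta>"
    and "generating_class \<Delta> \<D>"
    and "decomposable \<Delta> \<D>"
    and "2 \<le> card \<D>"
  shows "(\<exists>!B. \<exists>M. minimal_markov_basis L \<Delta> \<D> M \<and> B = up_to_sign M) \<longleftrightarrow>
    (\<exists>D D'. D \<noteq> D' \<and> boundary_cliques \<Delta> \<D> = {D, D'} \<and> (\<forall>D''\<in>\<D>. D'' \<subseteq> D \<union> D'))"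
proof -
  have gens: "\<D> \<noteq> {}" using assms(5) by auto
  interpret decomposable_model L \<Delta> \<D>
    using assms(1,3,4) gens by unfold_locales (auto simp: generating_class_def)
  show ?thesis (is "?unique \<longleftrightarrow> ?cover")
  proof
    assume ?unique
    have "E a b \<or> E a c \<or> E b c"
      if "a \<in> \<Delta>" "b \<in> \<Delta>" "c \<in> \<Delta>" "a \<noteq> b" "a \<noteq> c" "b \<noteq> c" for a b c
    proof (rule ccontr)
      assume "\<not> ?thesis"
      then have "\<not> {a, b} \<subseteq> D \<and> \<not> {a, c} \<subseteq> D \<and> \<not> {b, c} \<subseteq> D" if "D \<in> \<D>" for D
        using that \<open>a \<noteq> b\<close> \<open>a \<noteq> c\<close> \<open>b \<noteq> c\<close> gens_adjacent by blast
      from independent_triple_not_unique[OF assms(2) that this] show False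
        using \<open>?unique\<close> by blast
    qed
    then have "no_independent_triple \<Delta> E"
      unfolding no_independent_triple_def by blast
    then show ?cover using assms(5) by (rule boundary_cliques_cover)
  next
    assume ?cover
    then obtain D D' where b: "boundary_cliques \<Delta> \<D> = {D, D'}"
      and sub: "\<forall>D''\<in>\<D>. D'' \<subseteq> D \<union> D'" by (elim exE conjE)
    have "boundary_cliques \<Delta> \<D> \<subseteq> \<D>" by (auto simp: boundary_cliques_def)
    then have D: "D \<in> \<D>" "D' \<in> \<D>" unfolding b by simp_all
    have cover: "\<Delta> = D \<union> D'"
      unfolding Union_gens[symmetric] using D sub by (intro equalityI Union_least) auto
    have "no_independent_triple \<Delta> E"
      unfolding no_independent_triple_def
    proof (intro ballI impI)
      fix a b c assume abc: "a \<in> \<Delta>" "b \<in> \<Delta>" "c \<in> \<Delta>" "a \<noteq> b \<and> a \<noteq> c \<and> b \<noteq> c"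
      \<comment> \<open>By the pigeonhole principle two of the three vertices share one of the two
        cliques.\<close>
      have "(a \<in> D \<or> a \<in> D') \<and> (b \<in> D \<or> b \<in> D') \<and> (c \<in> D \<or> c \<in> D')"
        using abc(1-3) cover by simp
      then show "E a b \<or> E a c \<or> E b c"
        using abc(4) gens_adjacent[OF D(1)] gens_adjacent[OF D(2)] by metis
    qed
    then show ?unique
      using unique_minimal_markov_basis[OF D cover] swaps_connect_model by blast
  qed
qed

end
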